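(* Let $n\in\mathbb{N}$. (a) Let $\rho>0$ and let $A_d$ be the block operator matrix on $X_\rho^n$ of the abstract Cauchy problem (in terms of spatial derivatives) associated with a PDE in the class $(\ast)$ below, with polynomials $p_1,\dots,p_n,q$ such that $q$ has no zeros in $\rho\overline{\mathbb{D}}$. Then there exists a PDE in the class $(\ast)$ whose forward semidiscretization on $c_0(\mathbb{N}_0)^n$ with step size $h=1/\rho$, with block operator matrix $A_h^+$, is isometric to the given Cauchy problem. (b) Conversely, let $h>0$ and let $A_h^+$ be the block operator matrix on $c_0(\mathbb{N}_0)^n$ of the forward semidiscretization with spatial step size $h$ of a PDE in the class $(\ast)$ with polynomials $p_1,\dots,p_n,q$ such that $q$ has no zeros in $\overline{B(-1/h,1/h)}$. Then there exists an abstract Cauchy problem in terms of spatial derivatives, associated with a PDE in the class $(\ast)$, on the Herzog space with weight $\rho=1/h$, with block operator matrix $A_d$ on $X_\rho^n$, that is isometric to the given semidiscretization. In both cases "isometric" means that there is a surjective linear isometry $J:X_\rho^n\to c_0(\mathbb{N}_0)^n$ with $J A_d=A_h^+J$.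
   Context: $\mathbb{D}=\{z\in\mathbb{C}:|z|<1\}$; $B(c,r)$ is the open disc with center $c$ and radius $r$. For $\rho>0$ the Herzog space is $X_\rho=\{f:\mathbb{R}\to\mathbb{C}: f(x)=\sum_{k\ge0}\frac{a_k\rho^k}{k!}x^k,\ (a_k)_{k\ge0}\in c_0(\mathbb{N}_0)\}$ with norm $\|f\|=\sup_k|a_k|$; $\partial_x$ is bounded on it with spectrum $\rho\overline{\mathbb{D}}$. Products $X_\rho^n$ and $c_0(\mathbb{N}_0)^n$ carry the maximum norm. Class $(\ast)$: the PDEs of order $n$ in time $$\partial_t^nu+\sum_{j=1}^m a_{n,j}\,\partial_t^n\partial_x^ju+\sum_{0\le i<n,\ 0\le j\le m}a_{i,j}\,\partial_t^i\partial_x^ju=0,$$ with $m\in\mathbb{N}$ and complex constant coefficients (the case with all $a_{n,j}=0$, i.e. no mixed derivatives in the highest-order time term, is included). The associated polynomials are $p_i(z)=-\sum_{j=0}^m a_{i-1,j}z^j$ ($i=1,\dots,n$) and $q(z)=1+\sum_{j=1}^m a_{n,j}z^j$. For an operator $D$ with $q$ zero-free on $\sigma(D)$ let $$A(D)=\begin{pmatrix}0&I&0&\dots\\0&0&I&\dots\\ \vdots&\vdots&\vdots&\ddots\\ (p_1/q)(D)&(p_2/q)(D)&\dots&(p_n/q)(D)\end{pmatrix}$$ (Riesz–Dunford functional calculus). The abstract Cauchy problem of the PDE on the Herzog space is $\partial_t(u_1,\dots,u_n)^T=A_d(u_1,\dots,u_n)^T$ on $X_\rho^n$ with $A_d=A(\partial_x)$,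 considered when $q$ is zero-free on $\rho\overline{\mathbb{D}}$. Its forward semidiscretization with step $h$ is $\frac{d}{dt}(u_1,\dots,u_n)^T=A_h^+(u_1,\dots,u_n)^T$ on $c_0(\mathbb{N}_0)^n$ with $A_h^+=A(\Delta_h^+)$, considered when $q$ is zero-free on $\sigma(\Delta_h^+)=\overline{B(-1/h,1/h)}$; here $\Delta_h^+=\frac{B-I}{h}$ with $B$ the backward shift $B(x_0,x_1,\dots)=(x_1,x_2,\dots)$. *)

theory Defs
  imports "HOL-Complex_Analysis.Complex_Analysis"
begin

text \<open>
  The Herzog space depends on the real parameter \<open>\<rho>\<close>, so it cannot be a type. All spaces are
  therefore given by a carrier set \<open>V\<close> of complex-valued functions, with pointwise operations,
  together with a norm \<open>N\<close> that is meaningful on \<open>V\<close> only. Operators on \<open>V\<close> are functions whose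
  values outside \<open>V\<close> are irrelevant.
\<close>

section \<open>The spaces\<close>

definition c0_space :: "(nat \<Rightarrow> complex) set" where
  "c0_space = {a. a \<longlonglongrightarrow> 0}"

definition c0_norm :: "(nat \<Rightarrow> complex) \<Rightarrow> real" where
  "c0_norm a = (SUP k. cmod (a k))"

definition herzog_series :: "real \<Rightarrow> (nat \<Rightarrow> complex) \<Rightarrow> real \<Rightarrow> complex" where
  "herzog_series \<rho> a x = (\<Sum>k. a k * of_real \<rho> ^ k / fact k * of_real x ^ k)"

definition herzog_space :: "real \<Rightarrow> (real \<Rightarrow> complex) set" where
  "herzog_space \<rho> = herzog_series \<rho> ` c0_space"

definition herzog_coeffs :: "real \<Rightarrow> (real \<Rightarrow> complex) \<Rightarrow> nat \<Rightarrow> complex" where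
  "herzog_coeffs \<rho> f = (THE a. a \<in> c0_space \<and> f = herzog_series \<rho> a)"

definition herzog_norm :: "real \<Rightarrow> (real \<Rightarrow> complex) \<Rightarrow> real" where
  "herzog_norm \<rho> f = (SUP k. cmod (herzog_coeffs \<rho> f k))"

text \<open>
  The \<open>n\<close>-fold product with the maximum norm. Components are numbered \<open>1, \<dots>, n\<close>; the irrelevant
  components of the function representing a tuple are set to zero.
\<close>

definition tuple_space :: "nat \<Rightarrow> ('i \<Rightarrow> complex) set \<Rightarrow> (nat \<Rightarrow> 'i \<Rightarrow> complex) set" where
  "tuple_space n V = {u. (\<forall>i\<in>{1..n}. u i \<in> V) \<and> (\<forall>i. i \<notin> {1..n} \<longrightarrow> u i = (\<lambda>_. 0))}"

definition tuple_norm :: "nat \<Rightarrow> (('i \<Rightarrow> complex) \<Rightarrow> real) \<Rightarrow> (nat \<Rightarrow> 'i \<Rightarrow> complex) \<Rightarrow> real" where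
  "tuple_norm n N u = Max ((\<lambda>i. N (u i)) ` {1..n})"

section \<open>Spectrum and Riesz--Dunford functional calculus\<close>

definition shifted_op ::
  "(('i \<Rightarrow> complex) \<Rightarrow> 'i \<Rightarrow> complex) \<Rightarrow> complex \<Rightarrow> ('i \<Rightarrow> complex) \<Rightarrow> 'i \<Rightarrow> complex" where
  "shifted_op T z x = (\<lambda>i. z * x i - T x i)"

definition resolvent ::
  "('i \<Rightarrow> complex) set \<Rightarrow> (('i \<Rightarrow> complex) \<Rightarrow> 'i \<Rightarrow> complex) \<Rightarrow> complex
    \<Rightarrow> ('i \<Rightarrow> complex) \<Rightarrow> 'i \<Rightarrow> complex" where
  "resolvent V T z = inv_into V (shifted_op T z)"

definition spectrum ::
  "('i \<Rightarrow> complex) set \<Rightarrow> (('i \<Rightarrow> complex) \<Rightarrow> real) \<Rightarrow> (('i \<Rightarrow> complex) \<Rightarrow> 'i \<Rightarrow> complex)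
    \<Rightarrow> complex set" where
  "spectrum V N T =
     - {z. bij_betw (shifted_op T z) V V \<and> (\<exists>C. \<forall>x\<in>V. N (resolvent V T z x) \<le> C * N x)}"

text \<open>
  The contour integral of an operator-valued function \<open>F\<close>, with convergence in the operator norm
  of \<open>(V, N)\<close>. This is the definition of \<^const>\<open>has_contour_integral\<close>, i.e. a gauge integral over
  the parameter interval, with the absolute value of \<open>\<complex>\<close> replaced by the operator norm;
  \<open>measure lborel K\<close> is the length of the interval \<open>K\<close>.
\<close>

definition has_op_contour_integral ::
  "('i \<Rightarrow> complex) set \<Rightarrow> (('i \<Rightarrow> complex) \<Rightarrow> real)
    \<Rightarrow> (complex \<Rightarrow> ('i \<Rightarrow> complex) \<Rightarrow> 'i \<Rightarrow> complex) \<Rightarrow> (('i \<Rightarrow> complex) \<Rightarrow> 'i \<Rightarrow> complex)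
    \<Rightarrow> (real \<Rightarrow> complex) \<Rightarrow> bool" where
  "has_op_contour_integral V N F S \<gamma> \<longleftrightarrow>
     (\<forall>x\<in>V. S x \<in> V) \<and>
     (\<forall>\<epsilon>>0. \<exists>g. gauge g \<and>
        (\<forall>P. P tagged_division_of {0..1::real} \<and> g fine P \<longrightarrow>
          (\<forall>x\<in>V. N (\<lambda>i. (\<Sum>(t, K)\<in>P. of_real (measure lborel K) *
                          (F (\<gamma> t) x i * vector_derivative \<gamma> (at t within {0..1}))) - S x i)
                  \<le> \<epsilon> * N x)))"

text \<open>
  \<open>S = f(T) = 1/(2\<pi>\<i>) \<integral>\<^sub>\<gamma> f(z) (z - T)\<^sup>-\<^sup>1 dz\<close> for \<open>f\<close> holomorphic on an open neighbourhood \<open>\<Omega>\<close> of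
  the spectrum and a contour \<open>\<gamma>\<close> in \<open>\<Omega>\<close> that surrounds the spectrum once. The spectra of interest
  are closed discs, so a single closed path is enough and cycles are not needed. By Cauchy's theorem
  the restriction of \<open>S\<close> to \<open>V\<close> does not depend on \<open>\<Omega>\<close> and \<open>\<gamma>\<close>, which justifies the choice in
  \<open>riesz_dunford\<close> below.
\<close>

definition has_riesz_dunford ::
  "('i \<Rightarrow> complex) set \<Rightarrow> (('i \<Rightarrow> complex) \<Rightarrow> real) \<Rightarrow> (('i \<Rightarrow> complex) \<Rightarrow> 'i \<Rightarrow> complex)
    \<Rightarrow> (complex \<Rightarrow> complex) \<Rightarrow> (('i \<Rightarrow> complex) \<Rightarrow> 'i \<Rightarrow> complex) \<Rightarrow> bool" where
  "has_riesz_dunford V N T f S \<longleftrightarrow>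
     (\<exists>\<Omega> \<gamma>. open \<Omega> \<and> spectrum V N T \<subseteq> \<Omega> \<and> f holomorphic_on \<Omega> \<and>
        valid_path \<gamma> \<and> pathfinish \<gamma> = pathstart \<gamma> \<and> path_image \<gamma> \<subseteq> \<Omega> - spectrum V N T \<and>
        (\<forall>z\<in>spectrum V N T. winding_number \<gamma> z = 1) \<and>
        (\<forall>z. z \<notin> \<Omega> \<longrightarrow> winding_number \<gamma> z = 0) \<and>
        has_op_contour_integral V N
          (\<lambda>z x i. 1 / (2 * of_real pi * \<i>) * (f z * resolvent V T z x i)) S \<gamma>)"

definition riesz_dunford ::
  "('i \<Rightarrow> complex) set \<Rightarrow> (('i \<Rightarrow> complex) \<Rightarrow> real) \<Rightarrow> (('i \<Rightarrow> complex) \<Rightarrow> 'i \<Rightarrow> complex)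
    \<Rightarrow> (complex \<Rightarrow> complex) \<Rightarrow> ('i \<Rightarrow> complex) \<Rightarrow> 'i \<Rightarrow> complex" where
  "riesz_dunford V N T f = (SOME S. has_riesz_dunford V N T f S)"

section \<open>The class of PDEs and the block operator matrices\<close>

text \<open>
  A record stands for the equation \<open>\<Sum>i\<le>n. \<Sum>j\<le>m. a\<^sub>i\<^sub>j \<partial>\<^sub>t\<^sup>i \<partial>\<^sub>x\<^sup>j u = 0\<close> with time order \<open>n\<close>, space degree \<open>m\<close>
  and coefficients \<open>a\<^sub>i\<^sub>j\<close>, where \<open>a\<^sub>n\<^sub>0 = 1\<close> is the normalization of the term \<open>\<partial>\<^sub>t\<^sup>n u\<close>.
\<close>

record pde =
  time_order :: nat
  space_degree :: nat
  pde_coeff :: "nat \<Rightarrow> nat \<Rightarrow> complex"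

definition pde_class :: "nat \<Rightarrow> pde set" where
  "pde_class n = {E. time_order E = n \<and> space_degree E \<ge> 1 \<and> pde_coeff E n 0 = 1}"

definition pde_p :: "pde \<Rightarrow> nat \<Rightarrow> complex \<Rightarrow> complex" where
  "pde_p E i z = - (\<Sum>j=0..space_degree E. pde_coeff E (i - 1) j * z ^ j)"

definition pde_q :: "pde \<Rightarrow> complex \<Rightarrow> complex" where
  "pde_q E z = 1 + (\<Sum>j=1..space_degree E. pde_coeff E (time_order E) j * z ^ j)"

definition block_op ::
  "('i \<Rightarrow> complex) set \<Rightarrow> (('i \<Rightarrow> complex) \<Rightarrow> real) \<Rightarrow> (('i \<Rightarrow> complex) \<Rightarrow> 'i \<Rightarrow> complex)
    \<Rightarrow> pde \<Rightarrow> (nat \<Rightarrow> 'i \<Rightarrow> complex) \<Rightarrow> nat \<Rightarrow> 'i \<Rightarrow> complex" where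
  "block_op V N D E u i =
     (let n = time_order E in
      if 1 \<le> i \<and> i < n then u (i + 1)
      else if i = n
        then (\<lambda>s. \<Sum>j=1..n. riesz_dunford V N D (\<lambda>z. pde_p E j z / pde_q E z) (u j) s)
      else (\<lambda>_. 0))"

definition partial_x :: "(real \<Rightarrow> complex) \<Rightarrow> real \<Rightarrow> complex" where
  "partial_x f = (\<lambda>x. vector_derivative f (at x))"

definition backward_shift :: "(nat \<Rightarrow> complex) \<Rightarrow> nat \<Rightarrow> complex" where
  "backward_shift x = (\<lambda>k. x (Suc k))"

definition forward_difference :: "real \<Rightarrow> (nat \<Rightarrow> complex) \<Rightarrow> nat \<Rightarrow> complex" where
  "forward_difference h x = (\<lambda>k. (backward_shift x k - x k) / of_real h)"

definition A_d :: "real \<Rightarrow> pde \<Rightarrow> (nat \<Rightarrow> real \<Rightarrow> complex) \<Rightarrow> nat \<Rightarrow> real \<Rightarrow> complex" where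
  "A_d \<rho> E = block_op (herzog_space \<rho>) (herzog_norm \<rho>) partial_x E"

definition A_h_plus :: "real \<Rightarrow> pde \<Rightarrow> (nat \<Rightarrow> nat \<Rightarrow> complex) \<Rightarrow> nat \<Rightarrow> nat \<Rightarrow> complex" where
  "A_h_plus h E = block_op c0_space c0_norm (forward_difference h) E"

definition surj_linear_isometry ::
  "nat \<Rightarrow> ('i \<Rightarrow> complex) set \<Rightarrow> (('i \<Rightarrow> complex) \<Rightarrow> real)
    \<Rightarrow> ('j \<Rightarrow> complex) set \<Rightarrow> (('j \<Rightarrow> complex) \<Rightarrow> real)
    \<Rightarrow> ((nat \<Rightarrow> 'i \<Rightarrow> complex) \<Rightarrow> nat \<Rightarrow> 'j \<Rightarrow> complex) \<Rightarrow> bool" where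
  "surj_linear_isometry n V N W M J \<longleftrightarrow>
     J ` tuple_space n V = tuple_space n W \<and>
     (\<forall>u\<in>tuple_space n V. \<forall>v\<in>tuple_space n V.
        J (\<lambda>i s. u i s + v i s) = (\<lambda>i s. J u i s + J v i s)) \<and>
     (\<forall>c. \<forall>u\<in>tuple_space n V. J (\<lambda>i s. c * u i s) = (\<lambda>i s. c * J u i s)) \<and>
     (\<forall>u\<in>tuple_space n V. tuple_norm n M (J u) = tuple_norm n N u)"

definition isometric_problems ::
  "nat \<Rightarrow> real \<Rightarrow> ((nat \<Rightarrow> real \<Rightarrow> complex) \<Rightarrow> nat \<Rightarrow> real \<Rightarrow> complex)
    \<Rightarrow> ((nat \<Rightarrow> nat \<Rightarrow> complex) \<Rightarrow> nat \<Rightarrow> nat \<Rightarrow> complex) \<Rightarrow> bool" where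
  "isometric_problems n \<rho> A A' \<longleftrightarrow>
     (\<exists>J. surj_linear_isometry n (herzog_space \<rho>) (herzog_norm \<rho>) c0_space c0_norm J \<and>
          (\<forall>u\<in>tuple_space n (herzog_space \<rho>). J (A u) = A' (J u)))"

end

theory Submission
  imports Defs
begin

text \<open>
  The coefficient map \<open>f \<mapsto> (a\<^sub>k)\<close> is by construction an isometry of \<open>X\<^sub>\<rho>\<close> onto \<open>c\<^sub>0\<close>, and it turns
  \<open>\<partial>\<^sub>x\<close> into \<open>\<rho>B\<close>, where \<open>B\<close> is the backward shift. For \<open>h = 1/\<rho>\<close> the forward difference is
  \<open>\<rho>B - \<rho>\<close>. So the two operators are isometrically equivalent up to the scalar translation by \<open>\<rho>\<close>, and
  \<open>f(\<partial>\<^sub>x)\<close> corresponds to \<open>f(\<cdot> + \<rho>)\<close> applied to the forward difference. Translating the polynomials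
  \<open>p\<^sub>i, q\<close> of the PDE by \<open>\<plusminus>\<rho>\<close> gives polynomials again. Dividing all of them by the value of the
  translated \<open>q\<close> at \<open>0\<close>, which is a value of \<open>q\<close> at a point of the spectrum and hence nonzero,
  leaves the quotients \<open>p\<^sub>i/q\<close> unchanged and restores the normalization \<open>q(0) = 1\<close>; this is
  \<open>pde_substitution\<close>. The isometry is the coefficient map in each component.

  The substance is in the functional calculus, because \<^const>\<open>riesz_dunford\<close> is a choice among the
  operators that satisfy \<^const>\<open>has_riesz_dunford\<close>. To compare the choices in the two spaces one needs
  that such an operator exists and that it is unique on the space. Both are proved at once for
  every operator that acts as \<open>\<rho>B + c\<close> in isometric \<open>c\<^sub>0\<close>-coordinates (locale \<open>affine_shift\<close>), by an
  explicit formula. The resolvent is the Neumann series \<open>\<Sum>\<^sub>j \<rho>\<^sup>j B\<^sup>j / (z - c)\<^bsup>j+1\<^esup>\<close>, so the spectrum is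
  the closed disc around \<open>c\<close> of radius \<open>\<rho>\<close>, and Cauchy's formula, applied coefficientwise, gives
  \<open>f(\<rho>B + c) = \<Sum>\<^sub>j t\<^sub>j \<rho>\<^sup>j B\<^sup>j\<close> with the Taylor coefficients \<open>t\<^sub>j\<close> of \<open>f\<close> at \<open>c\<close>. The right-hand side
  mentions neither the contour nor the neighbourhood. It depends on \<open>c\<close> only through the \<open>t\<^sub>j\<close>,
  and these do not change when \<open>f\<close> and \<open>c\<close> are translated together.

  Uniqueness (\<open>riesz_dunford_coords\<close>) evaluates the operator integral coordinatewise on sequences
  with finite support, where only finitely many terms of the Neumann series occur, and extends by
  boundedness. Existence (\<open>riesz_dunford_exists\<close>) uses a circle slightly larger than the spectrum;
  there the series of coefficients is dominated by a geometric series, which makes the Riemann sums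
  converge in \<open>\<ell>\<^sup>1\<close> and hence in operator norm.
\<close>

section \<open>The sequence space and absolutely convergent series of shifts\<close>

lemma c0_norm_bdd: "a \<in> c0_space \<Longrightarrow> bdd_above (range (\<lambda>k. cmod (a k)))"
  unfolding c0_space_def
  using Bseq_bdd_above[OF convergent_imp_Bseq[OF convergentI[OF tendsto_norm_zero]], of a] by simp

lemma c0_norm_upper: "a \<in> c0_space \<Longrightarrow> cmod (a k) \<le> c0_norm a"
  unfolding c0_norm_def by (rule cSUP_upper[OF UNIV_I c0_norm_bdd])

lemma c0_norm_least: "(\<And>k. cmod (a k) \<le> B) \<Longrightarrow> c0_norm a \<le> B"
  unfolding c0_norm_def by (rule cSUP_least) auto

lemma c0_norm_nonneg: "a \<in> c0_space \<Longrightarrow> 0 \<le> c0_norm a"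
  using order_trans[OF norm_ge_zero c0_norm_upper[of a 0]] .

lemma c0_space_add: "a \<in> c0_space \<Longrightarrow> b \<in> c0_space \<Longrightarrow> (\<lambda>k. a k + b k) \<in> c0_space"
  unfolding c0_space_def using tendsto_add[of a 0 sequentially b 0] by simp

lemma c0_space_cmult: "a \<in> c0_space \<Longrightarrow> (\<lambda>k. r * a k) \<in> c0_space"
  unfolding c0_space_def using tendsto_mult_right_zero[of a sequentially r] by simp

lemma c0_space_shift: "a \<in> c0_space \<Longrightarrow> (\<lambda>k. a (Suc k)) \<in> c0_space"
  unfolding c0_space_def by (simp add: LIMSEQ_Suc)

text \<open>
  The operator \<open>\<Sum>\<^sub>j d\<^sub>j B\<^sup>j\<close>, where \<open>B\<close> is the backward shift. Resolvents, Riemann sums and the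
  functional calculus are all of this form; its norm is at most the \<open>\<ell>\<^sup>1\<close>-norm of \<open>d\<close>.
\<close>

definition shift_series :: "(nat \<Rightarrow> complex) \<Rightarrow> (nat \<Rightarrow> complex) \<Rightarrow> nat \<Rightarrow> complex" where
  "shift_series d x k = (\<Sum>j. d j * x (k + j))"

lemma shift_series_tail_summable:
  assumes d: "summable (\<lambda>j. cmod (d j))" and x: "\<And>i. i \<ge> k \<Longrightarrow> cmod (x i) \<le> M"
  shows "summable (\<lambda>j. cmod (d j * x (k + j)))"
proof (rule summable_comparison_test')
  show "summable (\<lambda>j. cmod (d j) * M)" using d by (rule summable_mult2)
  show "norm (cmod (d j * x (k + j))) \<le> cmod (d j) * M" for j
    using x[of "k + j"] by (auto simp: norm_mult intro: mult_left_mono)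
qed

text \<open>
  The bound uses only the tail of \<open>x\<close> from \<open>k\<close> on. This gives both the operator norm estimate
  (all \<open>k\<close>) and the fact that the result tends to \<open>0\<close>.
\<close>

lemma shift_series_tail_bound:
  assumes d: "summable (\<lambda>j. cmod (d j))" and x: "\<And>i. i \<ge> k \<Longrightarrow> cmod (x i) \<le> M"
  shows "cmod (shift_series d x k) \<le> (\<Sum>j. cmod (d j)) * M"
proof -
  have s: "summable (\<lambda>j. cmod (d j * x (k + j)))"
    using shift_series_tail_summable[OF assms] .
  have "cmod (shift_series d x k) \<le> (\<Sum>j. cmod (d j * x (k + j)))"
    unfolding shift_series_def by (rule summable_norm[OF s])
  also have "\<dots> \<le> (\<Sum>j. cmod (d j) * M)"
    by (rule suminf_le[OF _ s summable_mult2[OF d]])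
      (use x in \<open>auto simp: norm_mult intro: mult_left_mono\<close>)
  also have "\<dots> = (\<Sum>j. cmod (d j)) * M"
    using suminf_mult2[OF d] by simp
  finally show ?thesis .
qed

lemma shift_series_summable:
  assumes "summable (\<lambda>j. cmod (d j))" and "x \<in> c0_space"
  shows "summable (\<lambda>j. d j * x (k + j))"
  by (rule summable_norm_cancel, rule shift_series_tail_summable[OF assms(1) c0_norm_upper[OF assms(2)]])

lemma shift_series_bound:
  assumes "summable (\<lambda>j. cmod (d j))" and "x \<in> c0_space"
  shows "cmod (shift_series d x k) \<le> (\<Sum>j. cmod (d j)) * c0_norm x"
  by (rule shift_series_tail_bound[OF assms(1) c0_norm_upper[OF assms(2)]])

lemma shift_series_c0:
  assumes d: "summable (\<lambda>j. cmod (d j))" and x: "x \<in> c0_space"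
  shows "shift_series d x \<in> c0_space"
proof -
  define D where "D = (\<Sum>j. cmod (d j))"
  have D: "D \<ge> 0" unfolding D_def by (simp add: d suminf_nonneg)
  have "\<exists>K. \<forall>k\<ge>K. cmod (shift_series d x k) < e" if "e > 0" for e
  proof -
    have "0 < e / (D + 1)" using that D by simp
    with x obtain K where K: "\<And>i. i \<ge> K \<Longrightarrow> cmod (x i) < e / (D + 1)"
      unfolding c0_space_def LIMSEQ_iff by fastforce
    have "cmod (shift_series d x k) < e" if "k \<ge> K" for k
    proof -
      have "cmod (shift_series d x k) \<le> D * (e / (D + 1))"
        unfolding D_def using K that
        by (intro shift_series_tail_bound[OF d]) (simp add: D_def less_imp_le)
      also have "\<dots> < e" using D \<open>e > 0\<close> by (simp add: field_simps)
      finally show ?thesis .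
    qed
    thus ?thesis by blast
  qed
  thus ?thesis unfolding c0_space_def mem_Collect_eq LIMSEQ_iff diff_0_right by blast
qed

lemma shift_series_diff_coeffs:
  assumes "summable (\<lambda>j. cmod (d j))" "summable (\<lambda>j. cmod (e j))" "x \<in> c0_space"
  shows "shift_series (\<lambda>j. d j - e j) x k = shift_series d x k - shift_series e x k"
  using suminf_diff[OF shift_series_summable[OF assms(1,3), of k] shift_series_summable[OF assms(2,3), of k]]
  by (simp add: shift_series_def left_diff_distrib)

lemma shift_series_sum_coeffs:
  assumes "finite P" "\<And>p. p \<in> P \<Longrightarrow> summable (\<lambda>j. cmod (d p j))" "x \<in> c0_space"
  shows "shift_series (\<lambda>j. \<Sum>p\<in>P. a p * d p j) x k = (\<Sum>p\<in>P. a p * shift_series (d p) x k)"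
proof -
  have *: "p \<in> P \<Longrightarrow> summable (\<lambda>j. d p j * x (k + j))" for p
    using shift_series_summable[OF assms(2,3)] by blast
  have "shift_series (\<lambda>j. \<Sum>p\<in>P. a p * d p j) x k = (\<Sum>j. \<Sum>p\<in>P. a p * (d p j * x (k + j)))"
    unfolding shift_series_def by (simp add: sum_distrib_right mult.assoc)
  also have "\<dots> = (\<Sum>p\<in>P. \<Sum>j. a p * (d p j * x (k + j)))"
    by (rule suminf_sum, rule summable_mult, rule *)
  also have "\<dots> = (\<Sum>p\<in>P. a p * shift_series (d p) x k)"
    unfolding shift_series_def by (intro sum.cong refl suminf_mult *)
  finally show ?thesis .
qed

lemma shift_series_add:
  assumes "summable (\<lambda>j. cmod (d j))" "x \<in> c0_space" "y \<in> c0_space"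
  shows "shift_series d (\<lambda>i. x i + y i) k = shift_series d x k + shift_series d y k"
  unfolding shift_series_def distrib_left
  by (rule suminf_add[symmetric]; rule shift_series_summable[OF assms(1)]; fact assms)

lemma shift_series_finite_support:
  assumes "\<And>i. i \<ge> n \<Longrightarrow> x i = 0"
  shows "shift_series d x k = (\<Sum>j<n. d j * x (k + j))"
  unfolding shift_series_def by (rule suminf_finite) (use assms in auto)

section \<open>The Neumann series of the shift\<close>

text \<open>
  The coefficients of \<open>(w - \<rho>B)\<^sup>-\<^sup>1\<close> as a series in \<open>B\<close>.
\<close>

definition neumann_coeff :: "real \<Rightarrow> complex \<Rightarrow> nat \<Rightarrow> complex" where
  "neumann_coeff \<rho> w j = of_real \<rho> ^ j / w ^ Suc j"

lemma norm_neumann_coeff: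
  "\<rho> \<ge> 0 \<Longrightarrow> cmod (neumann_coeff \<rho> w j) = (\<rho> / cmod w) ^ j / cmod w"
  unfolding neumann_coeff_def by (simp add: norm_divide norm_power norm_mult power_divide)

lemma neumann_coeff_summable:
  assumes "\<rho> > 0" "cmod w > \<rho>"
  shows "summable (\<lambda>j. cmod (neumann_coeff \<rho> w j))"
proof -
  have "cmod (neumann_coeff \<rho> w j) = (\<rho> / cmod w) ^ j / cmod w" for j
    using norm_neumann_coeff assms by simp
  moreover have "summable (\<lambda>j. (\<rho> / cmod w) ^ j / cmod w)"
    using assms by (intro summable_divide summable_geometric) (auto simp: divide_less_eq)
  ultimately show ?thesis by simp
qed

lemma neumann_coeff_suminf:
  assumes "\<rho> > 0" "cmod w > \<rho>"
  shows "(\<Sum>j. cmod (neumann_coeff \<rho> w j)) = 1 / (cmod w - \<rho>)"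
proof -
  have w: "w \<noteq> 0" using assms by auto
  have "(\<Sum>j. cmod (neumann_coeff \<rho> w j)) = (\<Sum>j. (\<rho> / cmod w) ^ j / cmod w)"
    using norm_neumann_coeff assms by simp
  also have "\<dots> = (\<Sum>j. (\<rho> / cmod w) ^ j) / cmod w"
    using assms by (intro suminf_divide summable_geometric) (auto simp: divide_less_eq)
  also have "\<dots> = (1 / (1 - \<rho> / cmod w)) / cmod w"
    using assms w by (subst suminf_geometric) (auto simp: divide_less_eq)
  also have "\<dots> = 1 / (cmod w - \<rho>)"
    using assms w by (simp add: divide_simps)
  finally show ?thesis .
qed

lemma neumann_series_inverse:
  assumes "\<rho> > 0" "cmod w > \<rho>" "x \<in> c0_space"
  defines "y \<equiv> shift_series (neumann_coeff \<rho> w) x"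
  shows "w * y k - of_real \<rho> * y (Suc k) = x k"
proof -
  have w: "w \<noteq> 0" using assms by auto
  have s: "summable (\<lambda>j. neumann_coeff \<rho> w j * x (i + j))" for i
    by (rule shift_series_summable[OF neumann_coeff_summable[OF assms(1,2)] assms(3)])
  have "y k = neumann_coeff \<rho> w 0 * x k + (\<Sum>j. neumann_coeff \<rho> w (Suc j) * x (k + Suc j))"
    unfolding y_def shift_series_def using suminf_split_head[OF s[of k]] by simp
  also have "(\<lambda>j. neumann_coeff \<rho> w (Suc j) * x (k + Suc j)) =
      (\<lambda>j. of_real \<rho> / w * (neumann_coeff \<rho> w j * x (Suc k + j)))"
    by (auto simp: neumann_coeff_def)
  also have "(\<Sum>j. of_real \<rho> / w * (neumann_coeff \<rho> w j * x (Suc k + j))) = of_real \<rho> / w * y (Suc k)"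
    unfolding y_def shift_series_def by (rule suminf_mult[OF s])
  finally show ?thesis using w by (simp add: neumann_coeff_def field_simps)
qed

text \<open>
  A solution satisfies \<open>\<parallel>d\<parallel> \<le> (\<rho>/|w|) \<parallel>d\<parallel>\<close> with a factor below \<open>1\<close>. This makes \<open>w - \<rho>B\<close> injective.
\<close>

lemma shift_equation_c0_trivial:
  assumes "\<rho> > 0" "cmod w > \<rho>" "d \<in> c0_space" "\<And>k. w * d k = of_real \<rho> * d (Suc k)"
  shows "d k = 0"
proof -
  have w: "cmod w > 0" using assms by linarith
  have "cmod (d k) \<le> \<rho> / cmod w * c0_norm d" for k
  proof -
    have "cmod w * cmod (d k) = \<rho> * cmod (d (Suc k))"
      using arg_cong[OF assms(4)[of k], of cmod] assms(1) by (simp add: norm_mult)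
    also have "\<dots> \<le> \<rho> * c0_norm d" using c0_norm_upper[OF assms(3)] assms(1) by simp
    finally show ?thesis using w by (simp add: field_simps)
  qed
  hence "c0_norm d \<le> \<rho> / cmod w * c0_norm d" by (rule c0_norm_least)
  hence "(cmod w - \<rho>) * c0_norm d \<le> 0" using w by (simp add: field_simps)
  hence "c0_norm d \<le> 0" using assms(2) by (simp add: mult_le_0_iff)
  with c0_norm_upper[OF assms(3), of k] have "cmod (d k) \<le> 0" by (rule order_trans)
  thus ?thesis by simp
qed

section \<open>Operators similar to an affine function of the shift, and their spectrum\<close>

text \<open>
  Up to the isometry \<open>\<kappa>\<close>, the space is \<open>c\<^sub>0\<close> and the operator is \<open>\<rho>B + c\<close>. Both \<open>\<partial>\<^sub>x\<close> on the Herzog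
  space (with \<open>c = 0\<close>) and the forward difference on \<open>c\<^sub>0\<close> (with \<open>c = -\<rho>\<close>) are of this kind, so what
  is proved here about the calculus serves both sides of the comparison.
\<close>

locale affine_shift =
  fixes V :: "('i \<Rightarrow> complex) set" and N :: "('i \<Rightarrow> complex) \<Rightarrow> real"
    and T :: "('i \<Rightarrow> complex) \<Rightarrow> 'i \<Rightarrow> complex" and \<kappa> :: "('i \<Rightarrow> complex) \<Rightarrow> nat \<Rightarrow> complex"
    and \<rho> :: real and c :: complex
  assumes rho_pos: "\<rho> > 0"
    and coords_bij: "bij_betw \<kappa> V c0_space"
    and V_add: "u \<in> V \<Longrightarrow> v \<in> V \<Longrightarrow> (\<lambda>s. u s + v s) \<in> V"
    and V_cmult: "u \<in> V \<Longrightarrow> (\<lambda>s. r * u s) \<in> V"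
    and coords_add: "u \<in> V \<Longrightarrow> v \<in> V \<Longrightarrow> \<kappa> (\<lambda>s. u s + v s) = (\<lambda>k. \<kappa> u k + \<kappa> v k)"
    and coords_cmult: "u \<in> V \<Longrightarrow> \<kappa> (\<lambda>s. r * u s) = (\<lambda>k. r * \<kappa> u k)"
    and norm_coords: "u \<in> V \<Longrightarrow> N u = c0_norm (\<kappa> u)"
    and T_closed: "u \<in> V \<Longrightarrow> T u \<in> V"
    and coords_T: "u \<in> V \<Longrightarrow> \<kappa> (T u) = (\<lambda>k. of_real \<rho> * \<kappa> u (Suc k) + c * \<kappa> u k)"
begin

lemma coords_c0: "u \<in> V \<Longrightarrow> \<kappa> u \<in> c0_space"
  using coords_bij by (auto simp: bij_betw_def)

lemma coords_inj: "u \<in> V \<Longrightarrow> v \<in> V \<Longrightarrow> \<kappa> u = \<kappa> v \<Longrightarrow> u = v"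
  using coords_bij by (auto simp: bij_betw_def inj_on_def)

lemma coords_surj: "a \<in> c0_space \<Longrightarrow> \<exists>u\<in>V. \<kappa> u = a"
  using coords_bij by (auto simp: bij_betw_def image_iff) (metis imageE)

lemma coords_upper: "u \<in> V \<Longrightarrow> cmod (\<kappa> u k) \<le> N u"
  using c0_norm_upper[OF coords_c0] norm_coords by simp

lemma N_least: "u \<in> V \<Longrightarrow> (\<And>k. cmod (\<kappa> u k) \<le> M) \<Longrightarrow> N u \<le> M"
  using c0_norm_least norm_coords by simp

lemma N_nonneg: "u \<in> V \<Longrightarrow> 0 \<le> N u"
  using c0_norm_nonneg[OF coords_c0] norm_coords by simp

lemma V_diff: "u \<in> V \<Longrightarrow> v \<in> V \<Longrightarrow> (\<lambda>s. u s - v s) \<in> V"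
  using V_add[of u "\<lambda>s. (-1) * v s"] V_cmult[of v "-1"] by simp

lemma coords_diff: "u \<in> V \<Longrightarrow> v \<in> V \<Longrightarrow> \<kappa> (\<lambda>s. u s - v s) = (\<lambda>k. \<kappa> u k - \<kappa> v k)"
  using coords_add[of u "\<lambda>s. (-1) * v s"] V_cmult[of v "-1"] coords_cmult[of v "-1"] by simp

lemma V_sum_coords_sum:
  assumes "finite P" "\<And>p. p \<in> P \<Longrightarrow> u p \<in> V"
  shows "(\<lambda>s. \<Sum>p\<in>P. u p s) \<in> V \<and> \<kappa> (\<lambda>s. \<Sum>p\<in>P. u p s) = (\<lambda>k. \<Sum>p\<in>P. \<kappa> (u p) k)"
  using assms
proof (induction P rule: finite_induct)
  case empty
  obtain v where v: "v \<in> V"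
    using coords_surj[of "\<lambda>_. 0"] by (auto simp: c0_space_def)
  show ?case using V_cmult[OF v, of 0] coords_cmult[OF v, of 0] by simp
next
  case (insert p P)
  then show ?case using V_add[of "u p" "\<lambda>s. \<Sum>p\<in>P. u p s"]
      coords_add[of "u p" "\<lambda>s. \<Sum>p\<in>P. u p s"] by simp
qed

lemmas V_sum = V_sum_coords_sum[THEN conjunct1]
lemmas coords_sum = V_sum_coords_sum[THEN conjunct2]

lemma shifted_op_closed: "u \<in> V \<Longrightarrow> shifted_op T z u \<in> V"
  unfolding shifted_op_def by (intro V_diff V_cmult T_closed)

lemma coords_shifted_op:
  "u \<in> V \<Longrightarrow> \<kappa> (shifted_op T z u) k = (z - c) * \<kappa> u k - of_real \<rho> * \<kappa> u (Suc k)"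
  unfolding shifted_op_def
  by (simp add: coords_diff V_cmult T_closed coords_cmult coords_T algebra_simps)

lemma outside_disc: "z \<notin> cball c \<rho> \<longleftrightarrow> cmod (z - c) > \<rho>"
  by (auto simp: dist_norm norm_minus_commute)

lemma shifted_op_inj_on:
  assumes "z \<notin> cball c \<rho>"
  shows "inj_on (shifted_op T z) V"
proof (rule inj_onI)
  fix u v assume u: "u \<in> V" and v: "v \<in> V" and eq: "shifted_op T z u = shifted_op T z v"
  define d where "d = (\<lambda>k. \<kappa> u k - \<kappa> v k)"
  have "d \<in> c0_space" unfolding d_def using coords_c0[OF V_diff[OF u v]] coords_diff[OF u v] by simp
  moreover have "(z - c) * d k = of_real \<rho> * d (Suc k)" for k
    using arg_cong[OF eq, of "\<lambda>f. \<kappa> f k"] coords_shifted_op[OF u, of z k] coords_shifted_op[OF v, of z k]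
    unfolding d_def by (simp add: algebra_simps)
  ultimately have "d k = 0" for k
    using shift_equation_c0_trivial[OF rho_pos] assms outside_disc by blast
  hence "\<kappa> u = \<kappa> v" unfolding d_def by auto
  thus "u = v" using coords_inj u v by blast
qed

lemma resolvent_exists:
  assumes z: "z \<notin> cball c \<rho>" and v: "v \<in> V"
  shows "\<exists>u\<in>V. shifted_op T z u = v \<and> \<kappa> u = shift_series (neumann_coeff \<rho> (z - c)) (\<kappa> v)"
proof -
  have w: "cmod (z - c) > \<rho>" using z outside_disc by blast
  obtain u where u: "u \<in> V" "\<kappa> u = shift_series (neumann_coeff \<rho> (z - c)) (\<kappa> v)"
    using coords_surj[OF shift_series_c0[OF neumann_coeff_summable[OF rho_pos w] coords_c0[OF v]]] by blast
  have "\<kappa> (shifted_op T z u) = \<kappa> v"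
  proof
    fix k show "\<kappa> (shifted_op T z u) k = \<kappa> v k"
      unfolding coords_shifted_op[OF u(1)] u(2)
      by (rule neumann_series_inverse[OF rho_pos w coords_c0[OF v]])
  qed
  thus ?thesis using u coords_inj shifted_op_closed v by blast
qed

lemma resolvent_coords:
  assumes z: "z \<notin> cball c \<rho>" and v: "v \<in> V"
  shows "resolvent V T z v \<in> V"
    and "\<kappa> (resolvent V T z v) = shift_series (neumann_coeff \<rho> (z - c)) (\<kappa> v)"
proof -
  obtain u where u: "u \<in> V" "shifted_op T z u = v"
      "\<kappa> u = shift_series (neumann_coeff \<rho> (z - c)) (\<kappa> v)"
    using resolvent_exists[OF assms] by blast
  have "resolvent V T z v = u"
    unfolding resolvent_def using inv_into_f_f[OF shifted_op_inj_on[OF z] u(1)] u(2) by simp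
  with u show "resolvent V T z v \<in> V"
    and "\<kappa> (resolvent V T z v) = shift_series (neumann_coeff \<rho> (z - c)) (\<kappa> v)" by auto
qed

text \<open>
  Outside the disc the Neumann series is a bounded inverse. Inside, and on the boundary, the
  sequences \<open>b\<^sup>k\<close> with \<open>b = s(z - c)/\<rho>\<close> and \<open>s < 1\<close> lie in \<open>c\<^sub>0\<close>, have norm at least \<open>1\<close>, and
  \<open>z - T\<close> multiplies them by \<open>(1 - s)(z - c)\<close>. As \<open>s \<rightarrow> 1\<close> no bound for an inverse survives; this also
  covers the boundary, where there are no eigenvectors.
\<close>

lemma spectrum_eq: "spectrum V N T = cball c \<rho>"
proof (intro equalityI subsetI)
  fix z assume "z \<in> spectrum V N T"
  show "z \<in> cball c \<rho>"
  proof (rule ccontr)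
    assume z: "z \<notin> cball c \<rho>"
    hence w: "cmod (z - c) > \<rho>" using outside_disc by blast
    have "bij_betw (shifted_op T z) V V"
      unfolding bij_betw_def using shifted_op_inj_on[OF z] shifted_op_closed resolvent_exists[OF z]
      by (auto simp: image_iff) metis
    moreover have "N (resolvent V T z v) \<le> 1 / (cmod (z - c) - \<rho>) * N v" if v: "v \<in> V" for v
    proof (rule N_least[OF resolvent_coords(1)[OF z v]])
      show "cmod (\<kappa> (resolvent V T z v) k) \<le> 1 / (cmod (z - c) - \<rho>) * N v" for k
        unfolding resolvent_coords(2)[OF z v]
        using shift_series_bound[OF neumann_coeff_summable[OF rho_pos w] coords_c0[OF v]]
          neumann_coeff_suminf[OF rho_pos w] norm_coords[OF v] by metis
    qed
    ultimately show False using \<open>z \<in> spectrum V N T\<close> unfolding spectrum_def by blast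
  qed
next
  fix z assume "z \<in> cball c \<rho>"
  hence w: "cmod (z - c) \<le> \<rho>" using outside_disc by (meson not_less)
  show "z \<in> spectrum V N T"
  proof (rule ccontr)
    assume "z \<notin> spectrum V N T"
    then obtain C where bij: "bij_betw (shifted_op T z) V V"
      and C: "\<And>v. v \<in> V \<Longrightarrow> N (resolvent V T z v) \<le> C * N v"
      unfolding spectrum_def by auto
    have key: "1 \<le> \<bar>C\<bar> * ((1 - s) * \<rho>)" if s: "0 \<le> s" "s < 1" for s :: real
    proof -
      define b where "b = of_real s * (z - c) / of_real \<rho>"
      have b: "cmod b < 1"
      proof -
        have "s * cmod (z - c) \<le> s * \<rho>" using w s by (intro mult_left_mono) auto
        also have "\<dots> < \<rho>" using s rho_pos by simp
        finally show ?thesis unfolding b_def using rho_pos s by (simp add: norm_mult norm_divide)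
      qed
      hence "(\<lambda>k. b ^ k) \<in> c0_space" unfolding c0_space_def by (simp add: LIMSEQ_power_zero)
      then obtain u where u: "u \<in> V" "\<kappa> u = (\<lambda>k. b ^ k)" using coords_surj by blast
      let ?v = "shifted_op T z u"
      have v: "?v \<in> V" using shifted_op_closed u by blast
      have "N ?v \<le> (1 - s) * \<rho>"
      proof (rule N_least[OF v])
        fix k
        have "\<kappa> ?v k = of_real (1 - s) * (z - c) * b ^ k"
          unfolding coords_shifted_op[OF u(1)] u(2) using rho_pos
          by (simp add: b_def field_simps)
        hence "cmod (\<kappa> ?v k) = (1 - s) * cmod (z - c) * cmod b ^ k"
          using s by (simp add: norm_mult norm_power del: of_real_diff)
        also have "\<dots> \<le> (1 - s) * \<rho> * 1"
          using w b s rho_pos by (intro mult_mono power_le_one) auto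
        finally show "cmod (\<kappa> ?v k) \<le> (1 - s) * \<rho>" by simp
      qed
      have "resolvent V T z ?v = u"
        unfolding resolvent_def using bij u(1) by (simp add: bij_betw_def)
      have "1 = cmod (\<kappa> u 0)" using u by simp
      also have "\<dots> \<le> N u" using coords_upper u by blast
      also have "\<dots> \<le> C * N ?v" using C[OF v] \<open>resolvent V T z ?v = u\<close> by simp
      also have "\<dots> \<le> \<bar>C\<bar> * N ?v" using N_nonneg[OF v] by (intro mult_right_mono) auto
      also have "\<dots> \<le> \<bar>C\<bar> * ((1 - s) * \<rho>)" using \<open>N ?v \<le> _\<close> by (intro mult_left_mono) auto
      finally show ?thesis .
    qed
    \<comment> \<open>so close to 1 that \<open>\<bar>C\<bar> (1 - s) \<rho> < 1\<close>\<close>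
    define s where "s = 1 - 1 / (\<bar>C\<bar> * \<rho> + 1)"
    have pos: "\<bar>C\<bar> * \<rho> + 1 > 0" "\<bar>C\<bar> * \<rho> \<ge> 0" using rho_pos by (auto simp: add_nonneg_pos)
    have "0 \<le> s" "s < 1" unfolding s_def using pos by (auto simp: field_simps)
    hence "1 \<le> \<bar>C\<bar> * ((1 - s) * \<rho>)" by (rule key)
    thus False unfolding s_def using pos by (simp add: field_simps)
  qed
qed

end

section \<open>Contour integrals and Taylor coefficients\<close>

definition taylor_coeff :: "(complex \<Rightarrow> complex) \<Rightarrow> complex \<Rightarrow> nat \<Rightarrow> complex" where
  "taylor_coeff f c j = (deriv ^^ j) f c / fact j"

text \<open>
  The conditions on the path in \<^const>\<open>has_riesz_dunford\<close>, reduced to the centre \<open>c\<close> of the spectrum.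
  This is all that Cauchy's formula needs.
\<close>

definition encircles :: "(real \<Rightarrow> complex) \<Rightarrow> complex \<Rightarrow> complex set \<Rightarrow> bool" where
  "encircles \<gamma> c \<Omega> \<longleftrightarrow> valid_path \<gamma> \<and> pathfinish \<gamma> = pathstart \<gamma> \<and> path_image \<gamma> \<subseteq> \<Omega> - {c} \<and>
     winding_number \<gamma> c = 1 \<and> (\<forall>w. w \<notin> \<Omega> \<longrightarrow> winding_number \<gamma> w = 0)"

lemma encircles_circlepath:
  assumes "r > 0" "cball c r \<subseteq> \<Omega>"
  shows "encircles (circlepath c r) c \<Omega>"
  unfolding encircles_def
proof (intro conjI allI impI)
  show "path_image (circlepath c r) \<subseteq> \<Omega> - {c}"
    using assms by (auto simp: subset_iff)
  show "winding_number (circlepath c r) w = 0" if "w \<notin> \<Omega>" for w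
    using that assms
    by (intro winding_number_zero_outside[of _ "cball c r"]) (auto simp: subset_iff)
  show "winding_number (circlepath c r) c = 1"
    using assms by (simp add: winding_number_circlepath)
qed auto

text \<open>
  Write \<open>f = f(c) + (z - c) f\<^sub>1\<close>. Then \<open>f/(z - c)\<^bsup>j+2\<^esup>\<close> is \<open>f\<^sub>1/(z - c)\<^bsup>j+1\<^esup>\<close> plus a multiple of
  \<open>(z - c)\<^bsup>-(j+2)\<^esup>\<close>, which has a primitive. Repeating this reduces to Cauchy's formula for a simple
  pole, which holds for every such contour. Only the independence of the path is recorded, since
  the value can then be read off from a circle.
\<close>

lemma contour_integral_power_pole_independent:
  assumes "open \<Omega>" "f holomorphic_on \<Omega>" "c \<in> \<Omega>"
  shows "\<exists>t. \<forall>\<gamma>. encircles \<gamma> c \<Omega> \<longrightarrow> ((\<lambda>z. f z / (z - c) ^ Suc j) has_contour_integral t) \<gamma>"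
  using assms(2)
proof (induction j arbitrary: f)
  case 0
  show ?case
  proof (intro exI allI impI)
    fix \<gamma> assume "encircles \<gamma> c \<Omega>"
    thus "((\<lambda>z. f z / (z - c) ^ Suc 0) has_contour_integral 2 * pi * \<i> * 1 * f c) \<gamma>"
      using Cauchy_integral_formula_global[OF assms(1) 0 assms(3), of \<gamma>] unfolding encircles_def by simp
  qed
next
  case (Suc j)
  define f1 where "f1 = (\<lambda>z. if z = c then deriv f c else (f z - f c) / (z - c))"
  have df: "deriv (\<lambda>z. f z - f c) c = deriv f c"
    using holomorphic_on_imp_differentiable_at[OF Suc.prems assms(1,3)] by simp
  have "f1 holomorphic_on \<Omega>"
    by (rule pole_theorem_open_0[where g = "\<lambda>z. f z - f c" and a = c])
      (use Suc.prems assms in \<open>auto simp: f1_def df intro!: holomorphic_intros\<close>)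
  from Suc.IH[OF this] obtain t where
    t: "\<And>\<gamma>. encircles \<gamma> c \<Omega> \<Longrightarrow> ((\<lambda>z. f1 z / (z - c) ^ Suc j) has_contour_integral t) \<gamma>" by blast
  show ?case
  proof (intro exI allI impI)
    fix \<gamma> assume e: "encircles \<gamma> c \<Omega>"
    have "((\<lambda>z. f c / (z - c) ^ Suc (Suc j)) has_contour_integral 0) \<gamma>"
    proof (rule Cauchy_theorem_primitive[where S = "- {c}"
          and f = "\<lambda>z. - f c / of_nat (Suc j) / (z - c) ^ Suc j"])
      fix z assume z: "z \<in> - {c}"
      define m where "m = (of_nat (Suc j) :: complex)"
      have m: "m \<noteq> 0" unfolding m_def by (simp only: of_nat_eq_0_iff)
      have "((\<lambda>z. (z - c) ^ Suc j) has_field_derivative m * (z - c) ^ j) (at z within - {c})"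
        unfolding m_def using DERIV_power[of "\<lambda>z. z - c" 1 z "- {c}" "Suc j"]
        by (simp add: DERIV_ident[THEN DERIV_diff, OF DERIV_const, simplified] del: of_nat_Suc)
      from DERIV_divide[OF DERIV_const[of "- f c / m"] this] z
      have "((\<lambda>z. - f c / m / (z - c) ^ Suc j) has_field_derivative
          (0 * (z - c) ^ Suc j - - f c / m * (m * (z - c) ^ j)) / ((z - c) ^ Suc j * (z - c) ^ Suc j))
          (at z within - {c})" by simp
      moreover have "(0 * (z - c) ^ Suc j - - f c / m * (m * (z - c) ^ j)) / ((z - c) ^ Suc j * (z - c) ^ Suc j)
          = f c / (z - c) ^ Suc (Suc j)"
        using m z by (simp add: divide_simps)
      ultimately show "((\<lambda>z. - f c / of_nat (Suc j) / (z - c) ^ Suc j)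
          has_field_derivative f c / (z - c) ^ Suc (Suc j)) (at z within - {c})"
        unfolding m_def by simp
    qed (use e in \<open>auto simp: encircles_def\<close>)
    from has_contour_integral_add[OF t[OF e] this]
    have "((\<lambda>z. f1 z / (z - c) ^ Suc j + f c / (z - c) ^ Suc (Suc j)) has_contour_integral t) \<gamma>" by simp
    thus "((\<lambda>z. f z / (z - c) ^ Suc (Suc j)) has_contour_integral t) \<gamma>"
    proof (rule has_contour_integral_eq)
      fix z assume "z \<in> path_image \<gamma>"
      hence "z \<noteq> c" using e by (auto simp: encircles_def)
      thus "f1 z / (z - c) ^ Suc j + f c / (z - c) ^ Suc (Suc j) = f z / (z - c) ^ Suc (Suc j)"
        by (simp add: f1_def diff_divide_distrib)
    qed
  qed
qed

lemma has_contour_integral_taylor_coeff: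
  assumes "open \<Omega>" "f holomorphic_on \<Omega>" "c \<in> \<Omega>" "encircles \<gamma> c \<Omega>"
  shows "((\<lambda>z. f z / (z - c) ^ Suc j) has_contour_integral 2 * of_real pi * \<i> * taylor_coeff f c j) \<gamma>"
proof -
  obtain t where t: "\<And>\<gamma>. encircles \<gamma> c \<Omega> \<Longrightarrow> ((\<lambda>z. f z / (z - c) ^ Suc j) has_contour_integral t) \<gamma>"
    using contour_integral_power_pole_independent[OF assms(1-3)] by blast
  obtain r where r: "r > 0" "cball c r \<subseteq> \<Omega>"
    using assms(1,3) open_contains_cball by blast
  have "((\<lambda>z. f z / (z - c) ^ Suc j) has_contour_integral 2 * pi * \<i> / fact j * (deriv ^^ j) f c)
      (circlepath c r)"
    using r assms(2) by (intro Cauchy_has_contour_integral_higher_derivative_circlepath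
        holomorphic_on_imp_continuous_on holomorphic_on_subset[OF assms(2)]) auto
  with t[OF encircles_circlepath[OF r]] have "t = 2 * pi * \<i> / fact j * (deriv ^^ j) f c"
    by (rule has_contour_integral_unique)
  thus ?thesis using t[OF assms(4)] by (simp add: taylor_coeff_def)
qed

lemma taylor_coeff_bound:
  assumes "f holomorphic_on \<Omega>" "cball c r \<subseteq> \<Omega>" "r > 0"
  obtains M where "M \<ge> 0" "\<And>z. z \<in> sphere c r \<Longrightarrow> cmod (f z) \<le> M"
    "\<And>j. cmod (taylor_coeff f c j) \<le> M / r ^ j"
proof -
  have cont: "continuous_on (cball c r) f"
    by (rule holomorphic_on_imp_continuous_on[OF holomorphic_on_subset[OF assms(1,2)]])
  have "continuous_on (sphere c r) f"
    by (rule continuous_on_subset[OF cont]) auto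
  hence "bounded (f ` sphere c r)"
    by (intro compact_imp_bounded compact_continuous_image compact_sphere)
  then obtain M where M: "M > 0" "\<And>z. z \<in> sphere c r \<Longrightarrow> cmod (f z) \<le> M"
    unfolding bounded_pos by auto
  have "cmod (taylor_coeff f c j) \<le> M / r ^ j" for j
  proof -
    have "cmod ((deriv ^^ j) f c) \<le> fact j * M / r ^ j"
    proof (rule Cauchy_inequality[OF _ cont assms(3)])
      show "f holomorphic_on ball c r"
        by (rule holomorphic_on_subset[OF assms(1)]) (use assms(2) in auto)
    qed (use M in \<open>auto simp: dist_norm\<close>)
    thus ?thesis by (simp add: taylor_coeff_def norm_divide field_simps)
  qed
  thus thesis using that[OF less_imp_le[OF M(1)] M(2)] by blast
qed

lemma taylor_coeff_shift:
  assumes "open \<Omega>" "f holomorphic_on \<Omega>" "c \<in> \<Omega>"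
  shows "taylor_coeff (\<lambda>z. f (z + s)) (c - s) j = taylor_coeff f c j"
proof -
  have "(deriv ^^ j) (\<lambda>z. f (1 * z + s)) (c - s) = 1 ^ j * (deriv ^^ j) f (1 * (c - s) + s)"
  proof (rule higher_deriv_compose_linear'[OF assms(2) _ assms(1)])
    show "open ((\<lambda>z. z + s) -` \<Omega>)"
      by (intro open_vimage assms continuous_intros)
  qed (use assms in auto)
  thus ?thesis by (simp add: taylor_coeff_def)
qed

text \<open>
  The point \<open>x\<close> of the small disc used for \<open>z\<close> is the radial contraction of \<open>z\<close> by \<open>\<rho>/R\<close>.
\<close>

lemma cball_in_larger_cball:
  fixes c :: complex
  assumes "\<rho> > 0" "open \<Omega>" "cball c \<rho> \<subseteq> \<Omega>"
  obtains r where "r > \<rho>" "cball c r \<subseteq> \<Omega>"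
proof -
  obtain e where e: "e > 0" "(\<Union>x\<in>cball c \<rho>. ball x e) \<subseteq> \<Omega>"
    using compact_subset_open_imp_ball_epsilon_subset[OF compact_cball assms(2,3)] by blast
  have "cball c (\<rho> + e / 2) \<subseteq> \<Omega>"
  proof
    fix z assume z: "z \<in> cball c (\<rho> + e / 2)"
    define R where "R = \<rho> + e / 2"
    have R: "R > 0" unfolding R_def using assms e by simp
    define x where "x = c + of_real (\<rho> / R) * (z - c)"
    have zR: "cmod (z - c) \<le> R" using z by (simp add: R_def dist_norm norm_minus_commute)
    have "cmod (x - c) = \<rho> / R * cmod (z - c)"
      unfolding x_def using R assms(1) by (simp add: norm_mult norm_divide)
    also have "\<dots> \<le> \<rho> / R * R" using zR R assms(1) by (intro mult_left_mono) auto
    finally have x: "x \<in> cball c \<rho>" using R by (simp add: dist_norm norm_minus_commute)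
    have "z - x = of_real (1 - \<rho> / R) * (z - c)"
      unfolding x_def by (simp add: algebra_simps)
    moreover have R1: "1 - \<rho> / R \<ge> 0" using R e by (simp add: R_def)
    ultimately have "cmod (z - x) = (1 - \<rho> / R) * cmod (z - c)"
      by (simp only: norm_mult norm_of_real abs_of_nonneg)
    also have "\<dots> \<le> (1 - \<rho> / R) * R" using zR R1 by (rule mult_left_mono)
    also have "\<dots> = e / 2" using R by (simp add: R_def field_simps)
    also have "\<dots> < e" using e by simp
    finally have "z \<in> ball x e" by (simp add: dist_norm norm_minus_commute)
    thus "z \<in> \<Omega>" using x e(2) by blast
  qed
  thus thesis using that[of "\<rho> + e / 2"] e by simp
qed

section \<open>Riemann sums of operator-valued contour integrals\<close>

text \<open>
  Convergence of Riemann sums in \<open>\<ell>\<^sup>1\<close>. The tails of all Riemann sums and of the limit are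
  dominated by the tail of \<open>b\<close>, so only finitely many coordinates matter and finitely many gauges
  can be intersected.
\<close>

lemma uniform_riemann_sums:
  fixes \<psi> :: "real \<Rightarrow> nat \<Rightarrow> complex"
  assumes int: "\<And>j. ((\<lambda>t. \<psi> t j) has_integral d j) {0..1}"
    and b: "\<And>t j. t \<in> {0..1} \<Longrightarrow> cmod (\<psi> t j) \<le> b j" and sb: "summable b" and "\<epsilon> > 0"
  shows "\<exists>g. gauge g \<and> (\<forall>P. P tagged_division_of {0..1} \<and> g fine P \<longrightarrow>
           summable (\<lambda>j. cmod ((\<Sum>(t, K)\<in>P. of_real (measure lborel K) * \<psi> t j) - d j)) \<and>
           (\<Sum>j. cmod ((\<Sum>(t, K)\<in>P. of_real (measure lborel K) * \<psi> t j) - d j)) \<le> \<epsilon>)"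
proof -
  have b0: "b j \<ge> 0" for j using order_trans[OF norm_ge_zero b[of 0 j]] by simp
  have db: "cmod (d j) \<le> b j" for j
    using has_integral_bound[of "b j" "\<lambda>t. \<psi> t j" "d j" 0 1] b0 b int by simp
  have "\<epsilon> / 2 > 0" using \<open>\<epsilon> > 0\<close> by simp
  from suminf_exist_split[OF this summable_mult[OF sb, of 2]]
  obtain J where J: "norm (\<Sum>j. 2 * b (j + J)) < \<epsilon> / 2" by blast
  \<comment> \<open>the first \<open>J\<close> coordinates share \<open>\<epsilon>/2\<close>; \<open>J + 1\<close> because \<open>J\<close> may be 0\<close>
  define \<delta> where "\<delta> = \<epsilon> / (2 * (J + 1))"
  have \<delta>: "\<delta> > 0" unfolding \<delta>_def using \<open>\<epsilon> > 0\<close> by simp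
  have "J * \<delta> \<le> (J + 1) * \<delta>" using \<delta> by (intro mult_right_mono) auto
  also have "(J + 1) * \<delta> = \<epsilon> / 2" unfolding \<delta>_def by (simp add: divide_simps)
  finally have J\<delta>: "J * \<delta> \<le> \<epsilon> / 2" .
  define good where "good = (\<lambda>j g. gauge g \<and> (\<forall>P. P tagged_division_of {0..1} \<and> g fine P \<longrightarrow>
      cmod ((\<Sum>(t, K)\<in>P. of_real (measure lborel K) * \<psi> t j) - d j) < \<delta>))"
  have "\<forall>j. \<exists>g. good j g"
    unfolding good_def
    using int[unfolded has_integral_real scaleR_conv_of_real, rule_format, OF \<delta>] by (rule allI)
  then obtain g where "\<And>j. good j (g j)" using choice[of good] by blast
  hence g: "\<And>j. gauge (g j)"
    "\<And>j P. P tagged_division_of {0..1} \<Longrightarrow> g j fine P \<Longrightarrow>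
      cmod ((\<Sum>(t, K)\<in>P. of_real (measure lborel K) * \<psi> t j) - d j) < \<delta>"
    unfolding good_def by auto
  define G where "G = (\<lambda>x. \<Inter>{g j x | j. j \<in> {..<J}})"
  have "gauge G" unfolding G_def by (rule gauge_Inter) (use g in auto)
  have fine_sums: "summable (\<lambda>j. cmod ((\<Sum>(t, K)\<in>P. of_real (measure lborel K) * \<psi> t j) - d j)) \<and>
      (\<Sum>j. cmod ((\<Sum>(t, K)\<in>P. of_real (measure lborel K) * \<psi> t j) - d j)) \<le> \<epsilon>"
    if P: "P tagged_division_of {0..1}" and fine: "G fine P" for P
  proof -
    define E where "E = (\<lambda>j. cmod ((\<Sum>(t, K)\<in>P. of_real (measure lborel K) * \<psi> t j) - d j))"
    have E2: "E j \<le> 2 * b j" for j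
    proof -
      have "cmod (\<Sum>(t, K)\<in>P. of_real (measure lborel K) * \<psi> t j) \<le> (\<Sum>(t, K)\<in>P. measure lborel K * b j)"
      proof (rule sum_norm_le, clarify)
        fix t K assume "(t, K) \<in> P"
        hence "t \<in> {0..1}" by (rule tag_in_interval[OF P])
        thus "cmod (of_real (measure lborel K) * \<psi> t j) \<le> measure lborel K * b j"
          using b[of t j] by (simp add: norm_mult mult_left_mono)
      qed
      also have "\<dots> = (\<Sum>(t, K)\<in>P. measure lborel K) * b j"
        by (simp add: sum_distrib_right case_prod_unfold)
      also have "\<dots> = b j" using additive_content_tagged_division[of P 0 "1::real"] P by simp
      finally have "E j \<le> b j + cmod (d j)"
        unfolding E_def by (rule order_trans[OF norm_triangle_ineq4 add_right_mono])
      thus ?thesis using db[of j] by simp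
    qed
    have "summable (\<lambda>j. 2 * b j)" using sb by (rule summable_mult)
    hence sE: "summable E"
    proof (rule summable_comparison_test')
      show "norm (E j) \<le> 2 * b j" for j using E2[of j] by (simp add: E_def)
    qed
    have "(\<Sum>j. E j) = (\<Sum>j. E (j + J)) + (\<Sum>j<J. E j)"
      using suminf_split_initial_segment[OF sE, of J] by simp
    also have "\<dots> \<le> \<epsilon> / 2 + \<epsilon> / 2"
    proof (rule add_mono)
      have "(\<Sum>j. E (j + J)) \<le> (\<Sum>j. 2 * b (j + J))"
        by (rule suminf_le[OF E2 summable_ignore_initial_segment[OF sE]
              summable_mult[OF summable_ignore_initial_segment[OF sb]]])
      thus "(\<Sum>j. E (j + J)) \<le> \<epsilon> / 2" using J by simp
      have "(\<Sum>j<J. E j) \<le> (\<Sum>j<J. \<delta>)"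
      proof (rule sum_mono)
        fix j assume "j \<in> {..<J}"
        hence "g j fine P" using fine unfolding G_def fine_Inter by simp
        from less_imp_le[OF g(2)[OF P this]] show "E j \<le> \<delta>" unfolding E_def .
      qed
      also have "\<dots> \<le> \<epsilon> / 2" using J\<delta> by simp
      finally show "(\<Sum>j<J. E j) \<le> \<epsilon> / 2" .
    qed
    finally have "(\<Sum>j. E j) \<le> \<epsilon>" by simp
    with sE show ?thesis unfolding E_def by (rule conjI)
  qed
  show ?thesis
  proof (intro exI[of _ G] conjI[OF \<open>gauge G\<close>] allI impI)
    fix P assume "P tagged_division_of {0..1} \<and> G fine P"
    thus "summable (\<lambda>j. cmod ((\<Sum>(t, K)\<in>P. of_real (measure lborel K) * \<psi> t j) - d j)) \<and>
        (\<Sum>j. cmod ((\<Sum>(t, K)\<in>P. of_real (measure lborel K) * \<psi> t j) - d j)) \<le> \<epsilon>"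
      by (elim conjE) (rule fine_sums)
  qed
qed

lemma has_op_contour_integral_closed:
  "has_op_contour_integral V N F S \<gamma> \<Longrightarrow> v \<in> V \<Longrightarrow> S v \<in> V"
  unfolding has_op_contour_integral_def by (elim conjE) (erule (1) bspec)

lemma has_op_contour_integral_gauge:
  assumes "has_op_contour_integral V N F S \<gamma>" "\<epsilon> > 0"
  shows "\<exists>g. gauge g \<and> (\<forall>P. P tagged_division_of {0..1} \<and> g fine P \<longrightarrow> (\<forall>v\<in>V.
    N (\<lambda>i. (\<Sum>(t, K)\<in>P. of_real (measure lborel K) *
        (F (\<gamma> t) v i * vector_derivative \<gamma> (at t within {0..1}))) - S v i) \<le> \<epsilon> * N v))"
  using assms(1)[unfolded has_op_contour_integral_def, THEN conjunct2, rule_format, OF assms(2)] .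

section \<open>The functional calculus of an affine function of the shift\<close>

context affine_shift begin

text \<open>
  The coefficients of \<open>f(\<rho>B + c)\<close> as a series in \<open>B\<close>.
\<close>

definition calculus_coeff :: "(complex \<Rightarrow> complex) \<Rightarrow> nat \<Rightarrow> complex" where
  "calculus_coeff f j = of_real \<rho> ^ j * taylor_coeff f c j"

lemma calculus_coeff_bound:
  assumes "f holomorphic_on \<Omega>" "cball c r \<subseteq> \<Omega>" "r > \<rho>"
  obtains M where "M \<ge> 0" "\<And>z. z \<in> sphere c r \<Longrightarrow> cmod (f z) \<le> M"
    "\<And>j. cmod (calculus_coeff f j) \<le> M * (\<rho> / r) ^ j"
proof -
  have r: "r > 0" using assms(3) rho_pos by simp
  obtain M where M: "M \<ge> 0" "\<And>z. z \<in> sphere c r \<Longrightarrow> cmod (f z) \<le> M"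
    "\<And>j. cmod (taylor_coeff f c j) \<le> M / r ^ j"
    using taylor_coeff_bound[OF assms(1,2) r] by blast
  have "cmod (calculus_coeff f j) \<le> M * (\<rho> / r) ^ j" for j
  proof -
    have "cmod (calculus_coeff f j) = \<rho> ^ j * cmod (taylor_coeff f c j)"
      unfolding calculus_coeff_def using rho_pos by (simp add: norm_mult norm_power)
    also have "\<dots> \<le> \<rho> ^ j * (M / r ^ j)" using M(3) rho_pos by (intro mult_left_mono) auto
    finally show ?thesis by (simp add: power_divide mult.commute)
  qed
  with M that show thesis by blast
qed

lemma calculus_coeff_summable:
  assumes "open \<Omega>" "f holomorphic_on \<Omega>" "cball c \<rho> \<subseteq> \<Omega>"
  shows "summable (\<lambda>j. cmod (calculus_coeff f j))"
proof -
  obtain r where r: "r > \<rho>" "cball c r \<subseteq> \<Omega>" using cball_in_larger_cball[OF rho_pos assms(1,3)] by blast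
  obtain M where M: "\<And>j. cmod (calculus_coeff f j) \<le> M * (\<rho> / r) ^ j"
    using calculus_coeff_bound[OF assms(2) r(2,1)] by blast
  have "summable (\<lambda>j. M * (\<rho> / r) ^ j)"
    using r rho_pos by (intro summable_mult summable_geometric) auto
  thus ?thesis by (rule summable_comparison_test'[of _ 0]) (use M in auto)
qed

lemma tag_outside_disc:
  assumes "P tagged_division_of {0..1}" "(t, K) \<in> P" "path_image \<gamma> \<inter> cball c \<rho> = {}"
  shows "\<gamma> t \<notin> cball c \<rho>"
proof -
  have "\<gamma> t \<in> path_image \<gamma>"
    unfolding path_image_def by (rule imageI, rule tag_in_interval[OF assms(1,2)])
  thus ?thesis using assms(3) by blast
qed

lemma resolvent_sum_coords:
  assumes P: "P tagged_division_of {0..1::real}" and out: "path_image \<gamma> \<inter> cball c \<rho> = {}"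
    and v: "v \<in> V"
  shows "(\<lambda>i. \<Sum>(t, K)\<in>P. of_real (measure lborel K) *
           (1 / (2 * of_real pi * \<i>) * (f (\<gamma> t) * resolvent V T (\<gamma> t) v i) * g t)) \<in> V" (is "?R \<in> V")
    and "\<kappa> (\<lambda>i. \<Sum>(t, K)\<in>P. of_real (measure lborel K) *
           (1 / (2 * of_real pi * \<i>) * (f (\<gamma> t) * resolvent V T (\<gamma> t) v i) * g t)) k =
         (\<Sum>(t, K)\<in>P. of_real (measure lborel K) * (1 / (2 * of_real pi * \<i>) *
           (f (\<gamma> t) * shift_series (neumann_coeff \<rho> (\<gamma> t - c)) (\<kappa> v) k) * g t))" (is "_ = ?S")
proof -
  define a where "a = (\<lambda>p :: real \<times> real set. of_real (measure lborel (snd p)) *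
    (1 / (2 * of_real pi * \<i>) * f (\<gamma> (fst p)) * g (fst p)) :: complex)"
  define u where "u = (\<lambda>p::real \<times> real set. \<lambda>i. a p * resolvent V T (\<gamma> (fst p)) v i)"
  have eq: "?R = (\<lambda>i. \<Sum>p\<in>P. u p i)"
    unfolding u_def a_def by (simp add: case_prod_unfold mult_ac)
  have fin: "finite P" by (rule tagged_division_of_finite[OF P])
  have tag: "\<gamma> (fst p) \<notin> cball c \<rho>" if "p \<in> P" for p
    by (rule tag_outside_disc[OF P _ out, of _ "snd p"]) (use that in simp)
  have u: "u p \<in> V" "\<kappa> (u p) = (\<lambda>k. a p * shift_series (neumann_coeff \<rho> (\<gamma> (fst p) - c)) (\<kappa> v) k)"
    if "p \<in> P" for p
    unfolding u_def using resolvent_coords[OF tag[OF that] v] by (auto intro: V_cmult simp: coords_cmult)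
  show "?R \<in> V" unfolding eq by (rule V_sum[OF fin u(1)])
  have "\<kappa> ?R k = (\<Sum>p\<in>P. \<kappa> (u p) k)" unfolding eq using coords_sum[of P u] fin u(1) by simp
  also have "\<dots> = ?S" by (simp add: u a_def case_prod_unfold mult_ac)
  finally show "\<kappa> ?R k = ?S" .
qed

text \<open>
  Coordinates are bounded functionals, so convergence of the Riemann sums in operator norm implies
  convergence of each coordinate; this turns the operator integral into scalar contour integrals.
\<close>

lemma op_contour_integral_coord:
  assumes "has_op_contour_integral V N
          (\<lambda>z x i. 1 / (2 * of_real pi * \<i>) * (f z * resolvent V T z x i)) S \<gamma>"
    and out: "path_image \<gamma> \<inter> cball c \<rho> = {}" and v: "v \<in> V"
  shows "((\<lambda>z. 1 / (2 * of_real pi * \<i>) * (f z * shift_series (neumann_coeff \<rho> (z - c)) (\<kappa> v) k))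
           has_contour_integral \<kappa> (S v) k) \<gamma>"
  unfolding has_contour_integral_def has_integral_real scaleR_conv_of_real
proof (intro allI impI)
  fix e :: real assume "e > 0"
  \<comment> \<open>\<open>\<epsilon> * N v < e\<close>, also when \<open>N v = 0\<close>\<close>
  define \<epsilon> where "\<epsilon> = e / (2 * (N v + 1))"
  have Nv: "N v \<ge> 0" using N_nonneg v by blast
  have "\<epsilon> > 0" unfolding \<epsilon>_def using \<open>e > 0\<close> Nv by simp
  have "\<epsilon> * N v < e"
    unfolding \<epsilon>_def using \<open>e > 0\<close> Nv by (simp add: field_simps add_nonneg_pos)
  have SV: "S v \<in> V" by (rule has_op_contour_integral_closed[OF assms(1) v])
  obtain g where g: "gauge g" "\<And>P v. P tagged_division_of {0..1} \<Longrightarrow> g fine P \<Longrightarrow> v \<in> V \<Longrightarrow>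
      N (\<lambda>i. (\<Sum>(t, K)\<in>P. of_real (measure lborel K) * (1 / (2 * of_real pi * \<i>) *
          (f (\<gamma> t) * resolvent V T (\<gamma> t) v i) * vector_derivative \<gamma> (at t within {0..1}))) - S v i) \<le> \<epsilon> * N v"
    using has_op_contour_integral_gauge[OF assms(1) \<open>\<epsilon> > 0\<close>] by (elim exE conjE) simp
  show "\<exists>g. gauge g \<and> (\<forall>P. P tagged_division_of {0..1} \<and> g fine P \<longrightarrow>
      cmod ((\<Sum>(t, K)\<in>P. of_real (measure lborel K) * (1 / (2 * of_real pi * \<i>) *
          (f (\<gamma> t) * shift_series (neumann_coeff \<rho> (\<gamma> t - c)) (\<kappa> v) k) *
          vector_derivative \<gamma> (at t within {0..1}))) - \<kappa> (S v) k) < e)"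
  proof (intro exI conjI allI impI)
    show "gauge g" by fact
    fix P assume "P tagged_division_of {0..1} \<and> g fine P"
    hence P: "P tagged_division_of {0..1}" "g fine P" by auto
    note R = resolvent_sum_coords[OF P(1) out v, where f = f and
        g = "\<lambda>t. vector_derivative \<gamma> (at t within {0..1})"]
    show "cmod ((\<Sum>(t, K)\<in>P. of_real (measure lborel K) * (1 / (2 * of_real pi * \<i>) *
          (f (\<gamma> t) * shift_series (neumann_coeff \<rho> (\<gamma> t - c)) (\<kappa> v) k) *
          vector_derivative \<gamma> (at t within {0..1}))) - \<kappa> (S v) k) < e"
      using coords_upper[OF V_diff[OF R(1) SV], of k] g(2)[OF P v] \<open>\<epsilon> * N v < e\<close>
      unfolding coords_diff[OF R(1) SV] R(2) by linarith
  qed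
qed

text \<open>
  The limit is at distance at most \<open>1\<close> in operator norm from a Riemann sum, which is a finite combination
  of bounded resolvents. An estimate by the length of the path would not do: the derivative of a valid
  path may be unbounded near the finitely many points where it is not smooth.
\<close>

lemma op_contour_integral_bounded:
  assumes "has_op_contour_integral V N
          (\<lambda>z x i. 1 / (2 * of_real pi * \<i>) * (f z * resolvent V T z x i)) S \<gamma>"
    and out: "path_image \<gamma> \<inter> cball c \<rho> = {}"
  shows "\<exists>C\<ge>0. \<forall>v\<in>V. \<forall>k. cmod (\<kappa> (S v) k) \<le> C * N v"
proof -
  obtain g where g: "gauge g" "\<And>P v. P tagged_division_of {0..1} \<Longrightarrow> g fine P \<Longrightarrow> v \<in> V \<Longrightarrow>
      N (\<lambda>i. (\<Sum>(t, K)\<in>P. of_real (measure lborel K) * (1 / (2 * of_real pi * \<i>) *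
          (f (\<gamma> t) * resolvent V T (\<gamma> t) v i) * vector_derivative \<gamma> (at t within {0..1}))) - S v i) \<le> 1 * N v"
    using has_op_contour_integral_gauge[OF assms(1) zero_less_one] by (elim exE conjE) simp
  obtain P where P: "P tagged_division_of {0..1::real}" "g fine P"
    using fine_division_exists_real[OF g(1)] by blast
  note tags = tag_outside_disc[OF P(1) _ out]
  define w where "w = (\<lambda>t. 1 / (2 * of_real pi * \<i>) * f (\<gamma> t) * vector_derivative \<gamma> (at t within {0..1}))"
  define C where "C = (\<Sum>(t, K)\<in>P. measure lborel K * (cmod (w t) * (1 / (cmod (\<gamma> t - c) - \<rho>))))"
  have "C \<ge> 0" unfolding C_def
  proof (rule sum_nonneg, clarify)
    fix t K assume "(t, K) \<in> P"
    hence "cmod (\<gamma> t - c) - \<rho> > 0" using tags outside_disc by simp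
    thus "0 \<le> measure lborel K * (cmod (w t) * (1 / (cmod (\<gamma> t - c) - \<rho>)))"
      by (intro mult_nonneg_nonneg) auto
  qed
  have "cmod (\<kappa> (S v) k) \<le> (C + 1) * N v" if v: "v \<in> V" for v k
  proof -
    have SV: "S v \<in> V" by (rule has_op_contour_integral_closed[OF assms(1) v])
    note R = resolvent_sum_coords[OF P(1) out v, where f = f and
        g = "\<lambda>t. vector_derivative \<gamma> (at t within {0..1})"]
    let ?sum = "\<Sum>(t, K)\<in>P. of_real (measure lborel K) * (1 / (2 * of_real pi * \<i>) *
          (f (\<gamma> t) * shift_series (neumann_coeff \<rho> (\<gamma> t - c)) (\<kappa> v) k) *
          vector_derivative \<gamma> (at t within {0..1}))"
    have "cmod (?sum - \<kappa> (S v) k) \<le> N v"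
      using coords_upper[OF V_diff[OF R(1) SV], of k] g(2)[OF P v]
      unfolding coords_diff[OF R(1) SV] R(2) by linarith
    moreover have "cmod ?sum \<le> (\<Sum>(t, K)\<in>P. measure lborel K * (cmod (w t) * (1 / (cmod (\<gamma> t - c) - \<rho>))) * N v)"
    proof (rule sum_norm_le, clarify)
      fix t K assume tK: "(t, K) \<in> P"
      have out': "cmod (\<gamma> t - c) > \<rho>" using tags[OF tK] outside_disc by blast
      have "cmod (shift_series (neumann_coeff \<rho> (\<gamma> t - c)) (\<kappa> v) k) \<le> 1 / (cmod (\<gamma> t - c) - \<rho>) * N v"
        using shift_series_bound[OF neumann_coeff_summable[OF rho_pos out'] coords_c0[OF v], of k]
        unfolding neumann_coeff_suminf[OF rho_pos out'] norm_coords[OF v] .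
      hence "measure lborel K * (cmod (w t) * cmod (shift_series (neumann_coeff \<rho> (\<gamma> t - c)) (\<kappa> v) k))
        \<le> measure lborel K * (cmod (w t) * (1 / (cmod (\<gamma> t - c) - \<rho>) * N v))"
        by (intro mult_left_mono) auto
      thus "cmod (of_real (measure lborel K) * (1 / (2 * of_real pi * \<i>) *
          (f (\<gamma> t) * shift_series (neumann_coeff \<rho> (\<gamma> t - c)) (\<kappa> v) k) *
          vector_derivative \<gamma> (at t within {0..1}))) \<le>
          measure lborel K * (cmod (w t) * (1 / (cmod (\<gamma> t - c) - \<rho>))) * N v"
        by (simp add: w_def norm_mult norm_divide mult_ac)
    qed
    moreover have "\<dots> = C * N v" unfolding C_def by (simp add: sum_distrib_right case_prod_unfold)
    moreover have "cmod (\<kappa> (S v) k) \<le> cmod (?sum - \<kappa> (S v) k) + cmod ?sum"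
      using norm_triangle_sub[of "\<kappa> (S v) k" ?sum] by (simp add: norm_minus_commute)
    ultimately have "cmod (\<kappa> (S v) k) \<le> N v + C * N v" by linarith
    thus ?thesis by (simp add: algebra_simps)
  qed
  with \<open>C \<ge> 0\<close> show ?thesis by (intro exI[of _ "C + 1"]) auto
qed

lemma truncation_exists:
  assumes v: "v \<in> V" and "e > 0"
  shows "\<exists>n a b. a \<in> V \<and> b \<in> V \<and> \<kappa> v = (\<lambda>i. \<kappa> a i + \<kappa> b i) \<and> (\<forall>i\<ge>n. \<kappa> a i = 0) \<and> N b \<le> e"
proof -
  obtain n where n: "\<And>i. i \<ge> n \<Longrightarrow> cmod (\<kappa> v i) < e"
    using coords_c0[OF v] \<open>e > 0\<close> unfolding c0_space_def mem_Collect_eq LIMSEQ_iff diff_0_right by blast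
  define x where "x = (\<lambda>i. if i < n then \<kappa> v i else 0)"
  have "x \<in> c0_space" unfolding c0_space_def x_def mem_Collect_eq
    by (rule tendsto_eventually) (auto simp: eventually_sequentially intro!: exI[of _ n])
  then obtain a where a: "a \<in> V" "\<kappa> a = x" using coords_surj by blast
  define b where "b = (\<lambda>s. v s - a s)"
  have b: "b \<in> V" "\<kappa> b = (\<lambda>i. \<kappa> v i - x i)" unfolding b_def using V_diff coords_diff v a by auto
  have "N b \<le> e" by (rule N_least[OF b(1)]) (use n \<open>e > 0\<close> in \<open>auto simp: b(2) x_def not_less less_imp_le\<close>)
  with a b show ?thesis by (intro exI[of _ n] exI[of _ a] exI[of _ b]) (auto simp: x_def)
qed

text \<open>
  For a finitely supported vector each coordinate of the resolvent is a finite sum of powers of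
  \<open>1/(z - c)\<close>, and Cauchy's formula gives the claim. Both sides are additive and bounded in the vector,
  and truncations approximate every vector of \<open>c\<^sub>0\<close>.
\<close>

proposition riesz_dunford_coords:
  assumes "has_riesz_dunford V N T f S" and v: "v \<in> V"
  shows "S v \<in> V" and "\<kappa> (S v) = shift_series (calculus_coeff f) (\<kappa> v)"
proof -
  obtain \<Omega> \<gamma> where \<Omega>: "open \<Omega>" "cball c \<rho> \<subseteq> \<Omega>" "f holomorphic_on \<Omega>"
    and \<gamma>: "valid_path \<gamma>" "pathfinish \<gamma> = pathstart \<gamma>" "path_image \<gamma> \<subseteq> \<Omega> - cball c \<rho>"
      "\<forall>z\<in>cball c \<rho>. winding_number \<gamma> z = 1" "\<forall>z. z \<notin> \<Omega> \<longrightarrow> winding_number \<gamma> z = 0"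
    and int: "has_op_contour_integral V N
          (\<lambda>z x i. 1 / (2 * of_real pi * \<i>) * (f z * resolvent V T z x i)) S \<gamma>"
    using assms(1) unfolding has_riesz_dunford_def spectrum_eq by blast
  show "S v \<in> V" by (rule has_op_contour_integral_closed[OF int v])
  have c: "c \<in> cball c \<rho>" using rho_pos by simp
  have enc: "encircles \<gamma> c \<Omega>" unfolding encircles_def using \<gamma> c by auto
  have out: "path_image \<gamma> \<inter> cball c \<rho> = {}" using \<gamma>(3) by blast
  let ?d = "calculus_coeff f"
  have sd: "summable (\<lambda>j. cmod (?d j))" by (rule calculus_coeff_summable[OF \<Omega>(1,3,2)])
  note eval = op_contour_integral_coord[OF int out]
  have finite_support: "\<kappa> (S a) k = shift_series ?d (\<kappa> a) k" if a: "a \<in> V" "\<And>i. i \<ge> n \<Longrightarrow> \<kappa> a i = 0" for a n k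
  proof (rule has_contour_integral_unique[OF eval[OF a(1)]])
    have "((\<lambda>z. \<Sum>j<n. \<kappa> a (k + j) * of_real \<rho> ^ j / (2 * of_real pi * \<i>) * (f z / (z - c) ^ Suc j))
        has_contour_integral (\<Sum>j<n. \<kappa> a (k + j) * of_real \<rho> ^ j / (2 * of_real pi * \<i>) *
          (2 * of_real pi * \<i> * taylor_coeff f c j))) \<gamma>"
      using \<Omega> c enc by (intro has_contour_integral_sum has_contour_integral_lmul
          has_contour_integral_taylor_coeff[of \<Omega>]) auto
    also have "(\<Sum>j<n. \<kappa> a (k + j) * of_real \<rho> ^ j / (2 * of_real pi * \<i>) *
          (2 * of_real pi * \<i> * taylor_coeff f c j)) = shift_series ?d (\<kappa> a) k"
      using a(2) by (subst shift_series_finite_support[of n]) (auto simp: calculus_coeff_def mult_ac)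
    also have "(\<lambda>z. \<Sum>j<n. \<kappa> a (k + j) * of_real \<rho> ^ j / (2 * of_real pi * \<i>) * (f z / (z - c) ^ Suc j)) =
        (\<lambda>z. 1 / (2 * of_real pi * \<i>) * (f z * shift_series (neumann_coeff \<rho> (z - c)) (\<kappa> a) k))"
      using a(2) by (subst shift_series_finite_support[of n])
        (auto simp: neumann_coeff_def sum_distrib_left mult_ac)
    finally show "((\<lambda>z. 1 / (2 * of_real pi * \<i>) * (f z * shift_series (neumann_coeff \<rho> (z - c)) (\<kappa> a) k))
        has_contour_integral shift_series ?d (\<kappa> a) k) \<gamma>" .
  qed
  obtain C where C: "C \<ge> 0" "\<And>v k. v \<in> V \<Longrightarrow> cmod (\<kappa> (S v) k) \<le> C * N v"
    using op_contour_integral_bounded[OF int out] by blast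
  define D where "D = (\<Sum>j. cmod (?d j))"
  have D: "D \<ge> 0" unfolding D_def by (rule suminf_nonneg[OF sd]) simp
  show "\<kappa> (S v) = shift_series ?d (\<kappa> v)"
  proof
    fix k
    have "cmod (\<kappa> (S v) k - shift_series ?d (\<kappa> v) k) \<le> e" if "e > 0" for e
    proof -
      have "e / (C + D + 1) > 0" using that C D by simp
      obtain n a b where ab: "a \<in> V" "b \<in> V" "\<kappa> v = (\<lambda>i. \<kappa> a i + \<kappa> b i)"
          "\<forall>i\<ge>n. \<kappa> a i = 0" "N b \<le> e / (C + D + 1)"
        using truncation_exists[OF v \<open>e / (C + D + 1) > 0\<close>] by (elim exE conjE) (rule that)
      have "\<kappa> (S v) k = \<kappa> (S a) k + \<kappa> (S b) k"
      proof (rule has_contour_integral_unique[OF eval[OF v]])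
        show "((\<lambda>z. 1 / (2 * of_real pi * \<i>) * (f z * shift_series (neumann_coeff \<rho> (z - c)) (\<kappa> v) k))
           has_contour_integral \<kappa> (S a) k + \<kappa> (S b) k) \<gamma>"
        proof (rule has_contour_integral_eq[OF has_contour_integral_add[OF eval[OF ab(1)] eval[OF ab(2)]]])
          fix z assume "z \<in> path_image \<gamma>"
          hence "cmod (z - c) > \<rho>" using out outside_disc by blast
          then show "1 / (2 * of_real pi * \<i>) * (f z * shift_series (neumann_coeff \<rho> (z - c)) (\<kappa> a) k) +
              1 / (2 * of_real pi * \<i>) * (f z * shift_series (neumann_coeff \<rho> (z - c)) (\<kappa> b) k) =
              1 / (2 * of_real pi * \<i>) * (f z * shift_series (neumann_coeff \<rho> (z - c)) (\<kappa> v) k)"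
            unfolding ab(3)
              shift_series_add[OF neumann_coeff_summable[OF rho_pos \<open>cmod (z - c) > \<rho>\<close>] coords_c0[OF ab(1)] coords_c0[OF ab(2)]]
            by (simp only: distrib_left)
        qed
      qed
      moreover have "shift_series ?d (\<kappa> v) k = shift_series ?d (\<kappa> a) k + shift_series ?d (\<kappa> b) k"
        unfolding ab(3) by (rule shift_series_add[OF sd coords_c0[OF ab(1)] coords_c0[OF ab(2)]])
      moreover have "\<kappa> (S a) k = shift_series ?d (\<kappa> a) k"
        by (rule finite_support[OF ab(1) ab(4)[rule_format]])
      ultimately have "cmod (\<kappa> (S v) k - shift_series ?d (\<kappa> v) k) =
          cmod (\<kappa> (S b) k - shift_series ?d (\<kappa> b) k)" by simp
      also have "\<dots> \<le> cmod (\<kappa> (S b) k) + cmod (shift_series ?d (\<kappa> b) k)" by (rule norm_triangle_ineq4)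
      also have "\<dots> \<le> C * N b + D * N b"
        using C(2)[OF ab(2)] shift_series_bound[OF sd coords_c0[OF ab(2)]] norm_coords[OF ab(2)]
        unfolding D_def by (intro add_mono) auto
      also have "\<dots> \<le> (C + D) * (e / (C + D + 1))"
        unfolding distrib_right[symmetric] using ab(5) C(1) D by (intro mult_left_mono) auto
      also have "\<dots> \<le> e" using that C(1) D by (simp add: field_simps add_nonneg_pos)
      finally show ?thesis .
    qed
    hence "cmod (\<kappa> (S v) k - shift_series ?d (\<kappa> v) k) \<le> 0" by (rule field_le_epsilon) simp
    thus "\<kappa> (S v) k = shift_series ?d (\<kappa> v) k" by simp
  qed
qed

text \<open>
  On a circle of radius \<open>r > \<rho>\<close> the integrand has \<open>j\<close>-th coefficient of size at most \<open>M (\<rho>/r)\<^sup>j\<close>. This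
  domination gives \<open>\<ell>\<^sup>1\<close>-convergence of the coefficients, which bounds the operator norm.
\<close>

proposition riesz_dunford_exists:
  assumes \<Omega>: "open \<Omega>" "f holomorphic_on \<Omega>" "cball c \<rho> \<subseteq> \<Omega>"
  shows "\<exists>S. has_riesz_dunford V N T f S"
proof -
  obtain r where r: "r > \<rho>" "cball c r \<subseteq> \<Omega>" using cball_in_larger_cball[OF rho_pos \<Omega>(1,3)] by blast
  have r0: "r > 0" using r rho_pos by simp
  define \<gamma> where "\<gamma> = circlepath c r"
  let ?d = "calculus_coeff f"
  obtain M where M: "M \<ge> 0" "\<And>z. z \<in> sphere c r \<Longrightarrow> cmod (f z) \<le> M"
    "\<And>j. cmod (?d j) \<le> M * (\<rho> / r) ^ j"
    using calculus_coeff_bound[OF \<Omega>(2) r(2,1)] by blast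
  have sd: "summable (\<lambda>j. cmod (?d j))" by (rule calculus_coeff_summable[OF \<Omega>])
  define S where "S = (\<lambda>v. inv_into V \<kappa> (shift_series ?d (\<kappa> v)))"
  have S: "S v \<in> V" "\<kappa> (S v) = shift_series ?d (\<kappa> v)" if "v \<in> V" for v
  proof -
    have "shift_series ?d (\<kappa> v) \<in> \<kappa> ` V"
      using shift_series_c0[OF sd coords_c0[OF that]] coords_bij by (simp add: bij_betw_def)
    thus "S v \<in> V" "\<kappa> (S v) = shift_series ?d (\<kappa> v)"
      unfolding S_def by (rule inv_into_into, rule f_inv_into_f)
  qed
  have enc: "encircles \<gamma> c \<Omega>" unfolding \<gamma>_def by (rule encircles_circlepath[OF r0 r(2)])
  have img: "path_image \<gamma> = sphere c r" unfolding \<gamma>_def using r0 by simp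
  have out: "path_image \<gamma> \<inter> cball c \<rho> = {}" unfolding img using r(1) by auto
  have \<gamma>: "\<gamma> t \<in> sphere c r" if "t \<in> {0..1}" for t
    using that unfolding img[symmetric] path_image_def by blast
  have norm_\<gamma>: "cmod (\<gamma> t - c) = r" if "t \<in> {0..1}" for t
    using \<gamma>[OF that] by (simp add: dist_norm norm_minus_commute)
  define \<psi> where "\<psi> = (\<lambda>t j. 1 / (2 * of_real pi * \<i>) * (f (\<gamma> t) * neumann_coeff \<rho> (\<gamma> t - c) j) *
      vector_derivative \<gamma> (at t within {0..1}))"
  have \<psi>_int: "((\<lambda>t. \<psi> t j) has_integral ?d j) {0..1}" for j
  proof -
    have "((\<lambda>z. of_real \<rho> ^ j / (2 * of_real pi * \<i>) * (f z / (z - c) ^ Suc j)) has_contour_integral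
        of_real \<rho> ^ j / (2 * of_real pi * \<i>) * (2 * of_real pi * \<i> * taylor_coeff f c j)) \<gamma>"
      using \<Omega> enc rho_pos by (intro has_contour_integral_lmul has_contour_integral_taylor_coeff[of \<Omega>]) auto
    thus ?thesis
      unfolding has_contour_integral_def \<psi>_def neumann_coeff_def calculus_coeff_def by (simp add: mult_ac)
  qed
  have \<psi>_bound: "cmod (\<psi> t j) \<le> M * (\<rho> / r) ^ j" if t: "t \<in> {0..1}" for t j
  proof -
    have "vector_derivative \<gamma> (at t within {0..1}) = 2 * pi * \<i> * r * exp (2 * of_real pi * \<i> * t)"
      unfolding \<gamma>_def by (rule vector_derivative_circlepath01) (use t in auto)
    hence "cmod (vector_derivative \<gamma> (at t within {0..1})) = 2 * pi * r"
      using r0 by (simp add: norm_mult)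
    hence "cmod (\<psi> t j) = cmod (f (\<gamma> t)) * (\<rho> / r) ^ j"
      unfolding \<psi>_def using norm_neumann_coeff[of \<rho> "\<gamma> t - c" j] norm_\<gamma>[OF t] rho_pos r0
      by (simp add: norm_mult norm_divide)
    also have "\<dots> \<le> M * (\<rho> / r) ^ j"
      using M(2)[OF \<gamma>[OF t]] rho_pos r0 by (intro mult_right_mono) auto
    finally show ?thesis .
  qed
  have sM: "summable (\<lambda>j. M * (\<rho> / r) ^ j)"
    using r rho_pos by (intro summable_mult summable_geometric) auto
  have "has_op_contour_integral V N
      (\<lambda>z x i. 1 / (2 * of_real pi * \<i>) * (f z * resolvent V T z x i)) S \<gamma>"
    unfolding has_op_contour_integral_def
  proof (intro conjI ballI allI impI)
    fix v assume "v \<in> V" thus "S v \<in> V" by (rule S)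
  next
    fix \<epsilon> :: real assume "\<epsilon> > 0"
    obtain g where g: "gauge g" "\<And>P. P tagged_division_of {0..1} \<Longrightarrow> g fine P \<Longrightarrow>
        summable (\<lambda>j. cmod ((\<Sum>(t, K)\<in>P. of_real (measure lborel K) * \<psi> t j) - ?d j)) \<and>
        (\<Sum>j. cmod ((\<Sum>(t, K)\<in>P. of_real (measure lborel K) * \<psi> t j) - ?d j)) \<le> \<epsilon>"
      by (rule exE[OF uniform_riemann_sums[OF \<psi>_int \<psi>_bound sM \<open>\<epsilon> > 0\<close>]]) (assumption, elim conjE, simp)
    show "\<exists>g. gauge g \<and> (\<forall>P. P tagged_division_of {0..1} \<and> g fine P \<longrightarrow> (\<forall>v\<in>V.
        N (\<lambda>i. (\<Sum>(t, K)\<in>P. of_real (measure lborel K) * (1 / (2 * of_real pi * \<i>) *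
          (f (\<gamma> t) * resolvent V T (\<gamma> t) v i) * vector_derivative \<gamma> (at t within {0..1}))) - S v i) \<le> \<epsilon> * N v))"
    proof (intro exI conjI allI impI ballI)
      show "gauge g" by fact
      fix P v assume "P tagged_division_of {0..1} \<and> g fine P" and v: "v \<in> V"
      hence P: "P tagged_division_of {0..1}" "g fine P" by auto
      have fin: "finite P" by (rule tagged_division_of_finite[OF P(1)])
      have sneu: "summable (\<lambda>j. cmod (neumann_coeff \<rho> (\<gamma> (fst p) - c) j))" if "p \<in> P" for p
        using neumann_coeff_summable[OF rho_pos] tag_outside_disc[OF P(1) _ out, of "fst p" "snd p"]
          outside_disc that by simp
      define a where "a = (\<lambda>p :: real \<times> real set. of_real (measure lborel (snd p)) * (1 / (2 * of_real pi * \<i>) * f (\<gamma> (fst p)) *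
          vector_derivative \<gamma> (at (fst p) within {0..1})) :: complex)"
      define e where "e = (\<lambda>j. \<Sum>p\<in>P. a p * neumann_coeff \<rho> (\<gamma> (fst p) - c) j)"
      have e: "e = (\<lambda>j. \<Sum>(t, K)\<in>P. of_real (measure lborel K) * \<psi> t j)"
        unfolding e_def a_def \<psi>_def by (simp add: case_prod_unfold mult_ac)
      have sed: "summable (\<lambda>j. cmod (e j - ?d j))" "(\<Sum>j. cmod (e j - ?d j)) \<le> \<epsilon>"
        unfolding e using g(2)[OF P] by auto
      have se: "summable (\<lambda>j. cmod (e j))"
      proof (rule summable_comparison_test'[OF summable_add[OF sed(1) sd]])
        show "norm (cmod (e j)) \<le> cmod (e j - ?d j) + cmod (?d j)" for j
          using norm_triangle_ineq[of "e j - ?d j" "?d j"] by simp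
      qed
      note R = resolvent_sum_coords[OF P(1) out v, where f = f and
        g = "\<lambda>t. vector_derivative \<gamma> (at t within {0..1})"]
      have *: "(\<Sum>(t, K)\<in>P. of_real (measure lborel K) * (1 / (2 * of_real pi * \<i>) *
           (f (\<gamma> t) * shift_series (neumann_coeff \<rho> (\<gamma> t - c)) (\<kappa> v) k) *
           vector_derivative \<gamma> (at t within {0..1}))) = shift_series e (\<kappa> v) k" for k
      proof -
        have "shift_series e (\<kappa> v) k = (\<Sum>p\<in>P. a p * shift_series (neumann_coeff \<rho> (\<gamma> (fst p) - c)) (\<kappa> v) k)"
          unfolding e_def by (rule shift_series_sum_coeffs[OF fin _ coords_c0[OF v]]) (rule sneu)
        thus ?thesis by (simp add: a_def case_prod_unfold mult_ac)
      qed
      show "N (\<lambda>i. (\<Sum>(t, K)\<in>P. of_real (measure lborel K) * (1 / (2 * of_real pi * \<i>) *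
          (f (\<gamma> t) * resolvent V T (\<gamma> t) v i) * vector_derivative \<gamma> (at t within {0..1}))) - S v i) \<le> \<epsilon> * N v"
      proof (rule N_least[OF V_diff[OF R(1) S(1)[OF v]]])
        fix k
        have "cmod (shift_series e (\<kappa> v) k - shift_series ?d (\<kappa> v) k) \<le> (\<Sum>j. cmod (e j - ?d j)) * N v"
          using shift_series_bound[OF sed(1) coords_c0[OF v], of k] norm_coords[OF v]
            shift_series_diff_coeffs[OF se sd coords_c0[OF v]] by simp
        also have "\<dots> \<le> \<epsilon> * N v" using sed(2) N_nonneg[OF v] by (rule mult_right_mono)
        finally show "cmod (\<kappa> (\<lambda>i. (\<Sum>(t, K)\<in>P. of_real (measure lborel K) * (1 / (2 * of_real pi * \<i>) *
          (f (\<gamma> t) * resolvent V T (\<gamma> t) v i) * vector_derivative \<gamma> (at t within {0..1}))) - S v i) k) \<le> \<epsilon> * N v"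
          unfolding coords_diff[OF R(1) S(1)[OF v]] R(2) S(2)[OF v] * .
      qed
    qed
  qed
  moreover have "winding_number \<gamma> z = 1" if "z \<in> cball c \<rho>" for z
    unfolding \<gamma>_def using that r by (intro winding_number_circlepath) (auto simp: dist_norm norm_minus_commute)
  moreover have "path_image \<gamma> \<subseteq> \<Omega> - cball c \<rho>" unfolding img using r by auto
  ultimately show ?thesis
    using \<Omega> enc unfolding has_riesz_dunford_def spectrum_eq encircles_def by blast
qed

text \<open>
  Existence and uniqueness together determine the operator picked by the choice in
  \<^const>\<open>riesz_dunford\<close>.
\<close>

lemma riesz_dunford_some_coords:
  assumes "open \<Omega>" "f holomorphic_on \<Omega>" "cball c \<rho> \<subseteq> \<Omega>" and "v \<in> V"
  shows "riesz_dunford V N T f v \<in> V"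
    and "\<kappa> (riesz_dunford V N T f v) = shift_series (calculus_coeff f) (\<kappa> v)"
proof -
  have "has_riesz_dunford V N T f (riesz_dunford V N T f)"
    unfolding riesz_dunford_def by (rule someI_ex[OF riesz_dunford_exists[OF assms(1-3)]])
  thus "riesz_dunford V N T f v \<in> V"
    and "\<kappa> (riesz_dunford V N T f v) = shift_series (calculus_coeff f) (\<kappa> v)"
    using riesz_dunford_coords assms(4) by simp_all
qed
end

section \<open>The derivative on the Herzog space and the forward difference\<close>

lemma herzog_summable:
  assumes "a \<in> c0_space"
  shows "summable (\<lambda>k. a k * of_real \<rho> ^ k / fact k * (z::complex) ^ k)"
proof (rule summable_comparison_test')
  show "summable (\<lambda>k. c0_norm a * (inverse (fact k) * (\<bar>\<rho>\<bar> * cmod z) ^ k))"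
    by (intro summable_mult summable_exp)
  show "norm (a k * of_real \<rho> ^ k / fact k * z ^ k) \<le> c0_norm a * (inverse (fact k) * (\<bar>\<rho>\<bar> * cmod z) ^ k)" for k
  proof -
    have "norm (a k * of_real \<rho> ^ k / fact k * z ^ k) = cmod (a k) * (inverse (fact k) * (\<bar>\<rho>\<bar> * cmod z) ^ k)"
      by (simp add: norm_mult norm_power norm_inverse power_mult_distrib divide_inverse mult_ac)
    also have "\<dots> \<le> c0_norm a * (inverse (fact k) * (\<bar>\<rho>\<bar> * cmod z) ^ k)"
      by (intro mult_right_mono c0_norm_upper assms) auto
    finally show ?thesis .
  qed
qed

lemma herzog_series_add:
  assumes "a \<in> c0_space" "b \<in> c0_space"
  shows "herzog_series \<rho> (\<lambda>k. a k + b k) = (\<lambda>x. herzog_series \<rho> a x + herzog_series \<rho> b x)"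
proof
  fix x
  show "herzog_series \<rho> (\<lambda>k. a k + b k) x = herzog_series \<rho> a x + herzog_series \<rho> b x"
    unfolding herzog_series_def distrib_right add_divide_distrib
    by (rule suminf_add[symmetric]; rule herzog_summable; fact assms)
qed

lemma herzog_series_cmult:
  assumes "a \<in> c0_space"
  shows "herzog_series \<rho> (\<lambda>k. r * a k) = (\<lambda>x. r * herzog_series \<rho> a x)"
proof
  fix x
  show "herzog_series \<rho> (\<lambda>k. r * a k) x = r * herzog_series \<rho> a x"
    unfolding herzog_series_def
    using suminf_mult[OF herzog_summable[OF assms], of r \<rho> "of_real x"] by (simp add: mult.assoc)
qed

lemma herzog_series_0: "herzog_series \<rho> a 0 = a 0"
  unfolding herzog_series_def using powser_zero[of "\<lambda>k. a k * of_real \<rho> ^ k / fact k"] by simp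

lemma partial_x_herzog_series:
  assumes "a \<in> c0_space"
  shows "partial_x (herzog_series \<rho> a) = herzog_series \<rho> (\<lambda>k. of_real \<rho> * a (Suc k))"
proof
  fix x :: real
  define C where "C = (\<lambda>k. a k * of_real \<rho> ^ k / fact k)"
  have "((\<lambda>z. \<Sum>k. C k * z ^ k) has_field_derivative (\<Sum>k. diffs C k * of_real x ^ k)) (at (of_real x))"
    unfolding C_def by (rule termdiffs_strong_converges_everywhere[OF herzog_summable[OF assms]])
  from has_vector_derivative_real_field[OF this]
  have "(herzog_series \<rho> a has_vector_derivative (\<Sum>k. diffs C k * of_real x ^ k)) (at x)"
    unfolding herzog_series_def C_def .
  hence "partial_x (herzog_series \<rho> a) x = (\<Sum>k. diffs C k * of_real x ^ k)"
    unfolding partial_x_def by (rule vector_derivative_at)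
  also have "diffs C = (\<lambda>k. of_real \<rho> * a (Suc k) * of_real \<rho> ^ k / fact k)"
    by (auto simp: diffs_def C_def divide_simps simp del: of_nat_Suc)
  finally show "partial_x (herzog_series \<rho> a) x = herzog_series \<rho> (\<lambda>k. of_real \<rho> * a (Suc k)) x"
    unfolding herzog_series_def .
qed

text \<open>
  The \<open>0\<close>-th coefficient is the value at \<open>0\<close>, and differentiation shifts the coefficients.
\<close>

lemma herzog_series_inj:
  assumes "\<rho> > 0" "a \<in> c0_space" "b \<in> c0_space" "herzog_series \<rho> a = herzog_series \<rho> b"
  shows "a = b"
proof
  fix k
  show "a k = b k" using assms(2-4)
  proof (induction k arbitrary: a b)
    case 0
    thus ?case using herzog_series_0 by metis
  next
    case (Suc k)
    have "herzog_series \<rho> (\<lambda>k. of_real \<rho> * a (Suc k)) = herzog_series \<rho> (\<lambda>k. of_real \<rho> * b (Suc k))"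
      using partial_x_herzog_series[OF Suc.prems(1), of \<rho>] partial_x_herzog_series[OF Suc.prems(2), of \<rho>]
        Suc.prems(3) by simp
    from Suc.IH[OF c0_space_cmult[OF c0_space_shift[OF Suc.prems(1)]]
        c0_space_cmult[OF c0_space_shift[OF Suc.prems(2)]] this]
    show ?case using assms(1) by simp
  qed
qed

lemma herzog_coeffs_series:
  assumes "\<rho> > 0" "a \<in> c0_space"
  shows "herzog_coeffs \<rho> (herzog_series \<rho> a) = a"
  unfolding herzog_coeffs_def
  by (rule the_equality) (use assms herzog_series_inj in blast)+

lemma herzog_affine_shift:
  assumes "\<rho> > 0"
  shows "affine_shift (herzog_space \<rho>) (herzog_norm \<rho>) partial_x (herzog_coeffs \<rho>) \<rho> 0"
proof
  note coeffs = herzog_coeffs_series[OF assms]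
  show "bij_betw (herzog_coeffs \<rho>) (herzog_space \<rho>) c0_space"
    by (rule bij_betw_byWitness[where f' = "herzog_series \<rho>"]) (auto simp: herzog_space_def coeffs)
  fix u assume "u \<in> herzog_space \<rho>"
  then obtain a where a: "a \<in> c0_space" "u = herzog_series \<rho> a" unfolding herzog_space_def by blast
  show "herzog_norm \<rho> u = c0_norm (herzog_coeffs \<rho> u)"
    unfolding herzog_norm_def c0_norm_def ..
  have shift: "(\<lambda>k. of_real \<rho> * a (Suc k)) \<in> c0_space"
    by (rule c0_space_cmult[OF c0_space_shift[OF a(1)]])
  show "partial_x u \<in> herzog_space \<rho>"
    unfolding a(2) partial_x_herzog_series[OF a(1)] herzog_space_def using shift by blast
  show "herzog_coeffs \<rho> (partial_x u) = (\<lambda>k. of_real \<rho> * herzog_coeffs \<rho> u (Suc k) + 0 * herzog_coeffs \<rho> u k)"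
    unfolding a(2) partial_x_herzog_series[OF a(1)] coeffs[OF shift] coeffs[OF a(1)] by simp
  have cm: "(\<lambda>s. r * u s) = herzog_series \<rho> (\<lambda>k. r * a k)" for r
    unfolding a(2) by (rule herzog_series_cmult[OF a(1), symmetric])
  show "(\<lambda>s. r * u s) \<in> herzog_space \<rho>" for r
    unfolding cm herzog_space_def using c0_space_cmult[OF a(1)] by blast
  show "herzog_coeffs \<rho> (\<lambda>s. r * u s) = (\<lambda>k. r * herzog_coeffs \<rho> u k)" for r
    unfolding cm coeffs[OF c0_space_cmult[OF a(1)]] unfolding a(2) coeffs[OF a(1)] ..
  fix v assume "v \<in> herzog_space \<rho>"
  then obtain b where b: "b \<in> c0_space" "v = herzog_series \<rho> b" unfolding herzog_space_def by blast
  have add: "(\<lambda>s. u s + v s) = herzog_series \<rho> (\<lambda>k. a k + b k)"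
    unfolding a(2) b(2) by (rule herzog_series_add[OF a(1) b(1), symmetric])
  show "(\<lambda>s. u s + v s) \<in> herzog_space \<rho>"
    unfolding add herzog_space_def using c0_space_add[OF a(1) b(1)] by blast
  show "herzog_coeffs \<rho> (\<lambda>s. u s + v s) = (\<lambda>k. herzog_coeffs \<rho> u k + herzog_coeffs \<rho> v k)"
    unfolding add coeffs[OF c0_space_add[OF a(1) b(1)]] unfolding a(2) b(2) coeffs[OF a(1)] coeffs[OF b(1)] ..
qed (fact assms)

lemma forward_difference_affine_shift:
  assumes "\<rho> > 0"
  shows "affine_shift c0_space c0_norm (forward_difference (1 / \<rho>)) (\<lambda>a. a) \<rho> (- of_real \<rho>)"
proof
  have fd: "forward_difference (1 / \<rho>) a = (\<lambda>k. of_real \<rho> * a (Suc k) + - of_real \<rho> * a k)" for a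
    using assms unfolding forward_difference_def backward_shift_def by (auto simp: algebra_simps)
  fix a assume a: "a \<in> c0_space"
  show "forward_difference (1 / \<rho>) a = (\<lambda>k. of_real \<rho> * a (Suc k) + - of_real \<rho> * a k)" by (rule fd)
  show "forward_difference (1 / \<rho>) a \<in> c0_space"
    unfolding fd by (intro c0_space_add c0_space_cmult c0_space_shift a)
qed (use assms in \<open>auto simp: bij_betw_def intro: c0_space_add c0_space_cmult\<close>)

section \<open>Translating the symbols of a PDE\<close>

text \<open>
  Translation by \<open>s\<close> does not raise the degree, so the translated polynomials have the same space
  degree. The common factor \<open>1/q(s)\<close> restores the coefficient \<open>1\<close> of the pure time derivative.
\<close>

lemma pde_substitution:
  assumes E: "E \<in> pde_class n" and s: "pde_q E s \<noteq> 0"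
  shows "\<exists>E'\<in>pde_class n. (\<forall>z. pde_q E' z = pde_q E (z + s) / pde_q E s) \<and>
    (\<forall>i z. pde_p E' i z = pde_p E i (z + s) / pde_q E s)"
proof -
  define m where "m = space_degree E"
  define P where "P = (\<lambda>i. \<Sum>j\<le>m. monom (pde_coeff E i j) j)"
  define Q where "Q = (\<lambda>i. pcompose (P i) [:s, 1:])"
  have P: "poly (P i) z = (\<Sum>j\<le>m. pde_coeff E i j * z ^ j)" for i z
    unfolding P_def by (simp add: poly_sum poly_monom)
  have "degree (P i) \<le> m" for i
    unfolding P_def by (rule degree_sum_le) (auto intro: order_trans[OF degree_monom_le])
  hence degQ: "degree (Q i) \<le> m" for i
    unfolding Q_def using degree_pcompose_le[of "P i" "[:s, 1:]"] by (simp add: order_trans)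
  have Q: "(\<Sum>j\<le>m. coeff (Q i) j * z ^ j) = poly (P i) (z + s)" for i z
  proof -
    have "poly (Q i) z = (\<Sum>j\<le>m. coeff (Q i) j * z ^ j)"
      by (subst poly_as_sum_of_monoms'[OF degQ[of i], symmetric]) (simp add: poly_sum poly_monom)
    thus ?thesis by (simp add: Q_def poly_pcompose add.commute)
  qed
  have split0: "(\<Sum>j\<le>m. g j * z ^ j) = g 0 + (\<Sum>j=1..m. g j * z ^ j)" for g :: "nat \<Rightarrow> complex" and z
    by (simp add: atMost_atLeast0 sum.atLeast_Suc_atMost)
  have pE: "pde_p E i z = - poly (P (i - 1)) z" for i z
    unfolding pde_p_def P m_def by (simp add: atMost_atLeast0)
  have E1: "time_order E = n" "m \<ge> 1" "pde_coeff E n 0 = 1"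
    using E unfolding pde_class_def m_def by auto
  have qE: "pde_q E z = poly (P n) z" for z
    unfolding pde_q_def P split0 E1 m_def[symmetric] by simp
  define E' where "E' = \<lparr>time_order = n, space_degree = m, pde_coeff = (\<lambda>i j. coeff (Q i) j / pde_q E s)\<rparr>"
  have sumE': "(\<Sum>j\<le>m. pde_coeff E' i j * z ^ j) = poly (P i) (z + s) / pde_q E s" for i z
    unfolding E'_def Q[symmetric] by (simp add: sum_divide_distrib)
  have E'0: "pde_coeff E' n 0 = 1"
    using s poly_0_coeff_0[of "Q n"] by (simp add: E'_def qE Q_def poly_pcompose)
  have "E' \<in> pde_class n" unfolding pde_class_def using E1 E'0 by (simp add: E'_def)
  moreover have "pde_q E' z = pde_q E (z + s) / pde_q E s" for z
  proof -
    have "pde_q E' z = (\<Sum>j\<le>m. pde_coeff E' n j * z ^ j)"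
      unfolding pde_q_def split0 E'0 by (simp add: E'_def)
    thus ?thesis unfolding sumE' qE[of "z + s"] .
  qed
  moreover have "pde_p E' i z = pde_p E i (z + s) / pde_q E s" for i z
  proof -
    have "pde_p E' i z = - (\<Sum>j\<le>m. pde_coeff E' (i - 1) j * z ^ j)"
      unfolding pde_p_def by (simp add: E'_def atMost_atLeast0)
    thus ?thesis unfolding sumE' pE by simp
  qed
  ultimately show ?thesis by blast
qed

lemma pde_symbol_holomorphic:
  "open {z. pde_q E z \<noteq> 0}" "(\<lambda>z. pde_p E j z / pde_q E z) holomorphic_on {z. pde_q E z \<noteq> 0}"
proof -
  show "open {z. pde_q E z \<noteq> 0}"
    unfolding pde_q_def by (intro open_Collect_neq continuous_intros)
  show "(\<lambda>z. pde_p E j z / pde_q E z) holomorphic_on {z. pde_q E z \<noteq> 0}"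
    unfolding pde_q_def pde_p_def by (intro holomorphic_intros) auto
qed

section \<open>The isometry of the two problems\<close>

definition coeffs_map :: "nat \<Rightarrow> real \<Rightarrow> (nat \<Rightarrow> real \<Rightarrow> complex) \<Rightarrow> nat \<Rightarrow> nat \<Rightarrow> complex" where
  "coeffs_map n \<rho> u i = (if i \<in> {1..n} then herzog_coeffs \<rho> (u i) else (\<lambda>_. 0))"

lemma coeffs_map_isometry:
  assumes "\<rho> > 0"
  shows "surj_linear_isometry n (herzog_space \<rho>) (herzog_norm \<rho>) c0_space c0_norm (coeffs_map n \<rho>)"
proof -
  interpret H: affine_shift "herzog_space \<rho>" "herzog_norm \<rho>" partial_x "herzog_coeffs \<rho>" \<rho> 0
    by (rule herzog_affine_shift[OF assms])
  have comp: "i \<in> {1..n} \<Longrightarrow> u i \<in> herzog_space \<rho>" if "u \<in> tuple_space n (herzog_space \<rho>)" for u i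
    using that unfolding tuple_space_def by blast
  show ?thesis unfolding surj_linear_isometry_def
  proof (intro conjI ballI allI)
    show "coeffs_map n \<rho> ` tuple_space n (herzog_space \<rho>) = tuple_space n c0_space"
    proof (intro equalityI subsetI)
      fix w assume "w \<in> coeffs_map n \<rho> ` tuple_space n (herzog_space \<rho>)"
      then obtain u where u: "u \<in> tuple_space n (herzog_space \<rho>)" "w = coeffs_map n \<rho> u" by blast
      show "w \<in> tuple_space n c0_space"
        unfolding tuple_space_def u(2) coeffs_map_def using H.coords_c0[OF comp[OF u(1)]] by simp
    next
      fix w assume w: "w \<in> tuple_space n c0_space"
      define u where "u = (\<lambda>i. if i \<in> {1..n} then herzog_series \<rho> (w i) else (\<lambda>_. 0))"
      have "u \<in> tuple_space n (herzog_space \<rho>)"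
        using w unfolding tuple_space_def u_def herzog_space_def by auto
      moreover have "coeffs_map n \<rho> u = w"
      proof
        fix i
        show "coeffs_map n \<rho> u i = w i"
          using w herzog_coeffs_series[OF assms] unfolding tuple_space_def coeffs_map_def u_def by auto
      qed
      ultimately show "w \<in> coeffs_map n \<rho> ` tuple_space n (herzog_space \<rho>)" by blast
    qed
  next
    fix u v assume uv: "u \<in> tuple_space n (herzog_space \<rho>)" "v \<in> tuple_space n (herzog_space \<rho>)"
    show "coeffs_map n \<rho> (\<lambda>i s. u i s + v i s) = (\<lambda>i s. coeffs_map n \<rho> u i s + coeffs_map n \<rho> v i s)"
      unfolding coeffs_map_def using H.coords_add[OF comp[OF uv(1)] comp[OF uv(2)]] by (intro ext) simp
  next
    fix c u assume u: "u \<in> tuple_space n (herzog_space \<rho>)"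
    show "coeffs_map n \<rho> (\<lambda>i s. c * u i s) = (\<lambda>i s. c * coeffs_map n \<rho> u i s)"
      unfolding coeffs_map_def using H.coords_cmult[OF comp[OF u]] by (intro ext) simp
  next
    fix u assume u: "u \<in> tuple_space n (herzog_space \<rho>)"
    have "(\<lambda>i. c0_norm (coeffs_map n \<rho> u i)) ` {1..n} = (\<lambda>i. herzog_norm \<rho> (u i)) ` {1..n}"
      by (rule image_cong[OF refl]) (use H.norm_coords[OF comp[OF u]] in \<open>simp add: coeffs_map_def\<close>)
    thus "tuple_norm n c0_norm (coeffs_map n \<rho> u) = tuple_norm n (herzog_norm \<rho>) u"
      unfolding tuple_norm_def by simp
  qed
qed

text \<open>
  Only the last row of the block operators involves the functional calculus. There the two operators
  have the same coefficients as series in \<open>B\<close>, because Taylor coefficients are invariant under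
  translating the function and the centre together.
\<close>

lemma coeffs_map_intertwines:
  assumes \<rho>: "\<rho> > 0" and E: "E \<in> pde_class n" "E' \<in> pde_class n"
    and q: "\<forall>z\<in>cball 0 \<rho>. pde_q E z \<noteq> 0" and q': "\<forall>z\<in>cball (- of_real \<rho>) \<rho>. pde_q E' z \<noteq> 0"
    and quot: "\<And>j z. pde_p E' j z / pde_q E' z = pde_p E j (z + of_real \<rho>) / pde_q E (z + of_real \<rho>)"
    and u: "u \<in> tuple_space n (herzog_space \<rho>)"
  shows "coeffs_map n \<rho> (A_d \<rho> E u) = A_h_plus (1 / \<rho>) E' (coeffs_map n \<rho> u)"
proof -
  interpret H: affine_shift "herzog_space \<rho>" "herzog_norm \<rho>" partial_x "herzog_coeffs \<rho>" \<rho> 0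
    by (rule herzog_affine_shift[OF \<rho>])
  interpret D: affine_shift c0_space c0_norm "forward_difference (1 / \<rho>)" "\<lambda>a. a" \<rho> "- of_real \<rho>"
    by (rule forward_difference_affine_shift[OF \<rho>])
  let ?R = "\<lambda>j. riesz_dunford (herzog_space \<rho>) (herzog_norm \<rho>) partial_x (\<lambda>z. pde_p E j z / pde_q E z)"
  let ?R' = "\<lambda>j. riesz_dunford c0_space c0_norm (forward_difference (1 / \<rho>)) (\<lambda>z. pde_p E' j z / pde_q E' z)"
  have disc: "cball 0 \<rho> \<subseteq> {z. pde_q E z \<noteq> 0}" "cball (- of_real \<rho>) \<rho> \<subseteq> {z. pde_q E' z \<noteq> 0}"
    using q q' by auto
  have centre: "0 \<in> {z. pde_q E z \<noteq> 0}" by (rule subsetD[OF disc(1)]) (use \<rho> in simp)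
  have R: "?R j v \<in> herzog_space \<rho>" "herzog_coeffs \<rho> (?R j v) = ?R' j (herzog_coeffs \<rho> v)"
    if v: "v \<in> herzog_space \<rho>" for j v
  proof -
    show "?R j v \<in> herzog_space \<rho>"
      by (rule H.riesz_dunford_some_coords[OF pde_symbol_holomorphic disc(1) v])
    have "taylor_coeff (\<lambda>z. pde_p E' j z / pde_q E' z) (- of_real \<rho>) k =
        taylor_coeff (\<lambda>z. pde_p E j z / pde_q E z) 0 k" for k
      unfolding quot
      using taylor_coeff_shift[OF pde_symbol_holomorphic(1)[of E] pde_symbol_holomorphic(2)[of E j] centre,
          of "of_real \<rho>" k] by simp
    hence "D.calculus_coeff (\<lambda>z. pde_p E' j z / pde_q E' z) = H.calculus_coeff (\<lambda>z. pde_p E j z / pde_q E z)"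
      unfolding D.calculus_coeff_def H.calculus_coeff_def by (intro ext) simp
    thus "herzog_coeffs \<rho> (?R j v) = ?R' j (herzog_coeffs \<rho> v)"
      unfolding H.riesz_dunford_some_coords(2)[OF pde_symbol_holomorphic disc(1) v]
        D.riesz_dunford_some_coords(2)[OF pde_symbol_holomorphic disc(2) H.coords_c0[OF v]] by simp
  qed
  have comp: "i \<in> {1..n} \<Longrightarrow> u i \<in> herzog_space \<rho>" for i
    using u unfolding tuple_space_def by blast
  have n: "time_order E = n" "time_order E' = n" using E unfolding pde_class_def by auto
  show ?thesis
  proof
    fix i
    consider "1 \<le> i" "i < n" | "i = n" "1 \<le> n" | "i \<notin> {1..n}" by fastforce
    thus "coeffs_map n \<rho> (A_d \<rho> E u) i = A_h_plus (1 / \<rho>) E' (coeffs_map n \<rho> u) i"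
    proof cases
      case 1
      thus ?thesis by (simp add: coeffs_map_def A_d_def A_h_plus_def block_op_def n)
    next
      case 2
      have "coeffs_map n \<rho> (A_d \<rho> E u) n = herzog_coeffs \<rho> (\<lambda>s. \<Sum>j=1..n. ?R j (u j) s)"
        using 2 by (simp add: coeffs_map_def A_d_def block_op_def n)
      also have "\<dots> = (\<lambda>k. \<Sum>j=1..n. herzog_coeffs \<rho> (?R j (u j)) k)"
        by (rule H.coords_sum[OF finite_atLeastAtMost R(1)[OF comp]])
      also have "\<dots> = (\<lambda>k. \<Sum>j=1..n. ?R' j (herzog_coeffs \<rho> (u j)) k)"
        using R(2)[OF comp] by simp
      also have "\<dots> = A_h_plus (1 / \<rho>) E' (coeffs_map n \<rho> u) n"
        using 2 by (simp add: coeffs_map_def A_h_plus_def block_op_def n)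
      finally show ?thesis using 2 by simp
    next
      case 3
      hence "\<not> (1 \<le> i \<and> i < n)" "i \<noteq> n \<or> n = 0" by auto
      with 3 show ?thesis by (auto simp: coeffs_map_def A_h_plus_def block_op_def n)
    qed
  qed
qed

lemma isometric_if_symbols_translated:
  assumes "\<rho> > 0" "E \<in> pde_class n" "E' \<in> pde_class n"
    "\<forall>z\<in>cball 0 \<rho>. pde_q E z \<noteq> 0" "\<forall>z\<in>cball (- of_real \<rho>) \<rho>. pde_q E' z \<noteq> 0"
    "\<And>j z. pde_p E' j z / pde_q E' z = pde_p E j (z + of_real \<rho>) / pde_q E (z + of_real \<rho>)"
  shows "isometric_problems n \<rho> (A_d \<rho> E) (A_h_plus (1 / \<rho>) E')"
  unfolding isometric_problems_def
  using coeffs_map_isometry[OF assms(1)] coeffs_map_intertwines[OF assms] by blast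

lemma translate_disc: "z + s \<in> cball a \<rho> \<longleftrightarrow> z \<in> cball (a - s) \<rho>" for z :: complex
  by (simp add: dist_norm algebra_simps)

theorem theorem5p7:
  fixes n :: nat
  assumes "n \<ge> 1"
  shows "(\<forall>\<rho>>0. \<forall>E\<in>pde_class n. (\<forall>z\<in>cball 0 \<rho>. pde_q E z \<noteq> 0) \<longrightarrow>
            (\<exists>E'\<in>pde_class n.
               (\<forall>z\<in>cball (- 1 / of_real (1 / \<rho>)) (1 / (1 / \<rho>)). pde_q E' z \<noteq> 0) \<and>
               isometric_problems n \<rho> (A_d \<rho> E) (A_h_plus (1 / \<rho>) E')))
       \<and> (\<forall>h>0. \<forall>E\<in>pde_class n. (\<forall>z\<in>cball (- 1 / of_real h) (1 / h). pde_q E z \<noteq> 0) \<longrightarrow>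
            (\<exists>E'\<in>pde_class n.
               (\<forall>z\<in>cball 0 (1 / h). pde_q E' z \<noteq> 0) \<and>
               isometric_problems n (1 / h) (A_d (1 / h) E') (A_h_plus h E)))"
proof (intro conjI allI ballI impI)
  \<comment> \<open>translate the symbols by \<open>\<rho>\<close>, which maps the disc around \<open>-\<rho>\<close> to the one around 0\<close>
  fix \<rho> :: real and E
  assume \<rho>: "\<rho> > 0" and E: "E \<in> pde_class n" and q: "\<forall>z\<in>cball 0 \<rho>. pde_q E z \<noteq> 0"
  have q\<rho>: "pde_q E (of_real \<rho>) \<noteq> 0" using q \<rho> by simp
  obtain E' where E': "E' \<in> pde_class n" "\<And>z. pde_q E' z = pde_q E (z + of_real \<rho>) / pde_q E (of_real \<rho>)"
    "\<And>i z. pde_p E' i z = pde_p E i (z + of_real \<rho>) / pde_q E (of_real \<rho>)"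
    using pde_substitution[OF E q\<rho>] by blast
  have q': "\<forall>z\<in>cball (- of_real \<rho>) \<rho>. pde_q E' z \<noteq> 0"
    using q q\<rho> translate_disc[of _ "of_real \<rho>" 0 \<rho>] unfolding E'(2) by auto
  have "isometric_problems n \<rho> (A_d \<rho> E) (A_h_plus (1 / \<rho>) E')"
    by (rule isometric_if_symbols_translated[OF \<rho> E E'(1) q q']) (use q\<rho> in \<open>simp add: E'(2,3)\<close>)
  moreover have "cball (- 1 / of_real (1 / \<rho>)) (1 / (1 / \<rho>)) = cball (- of_real \<rho> :: complex) \<rho>" by simp
  ultimately show "\<exists>E'\<in>pde_class n.
      (\<forall>z\<in>cball (- 1 / of_real (1 / \<rho>)) (1 / (1 / \<rho>)). pde_q E' z \<noteq> 0) \<and>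
      isometric_problems n \<rho> (A_d \<rho> E) (A_h_plus (1 / \<rho>) E')"
    using E'(1) q' by metis
next
  \<comment> \<open>translate the symbols by \<open>-\<rho>\<close> with \<open>\<rho> = 1/h\<close>, inverting the substitution of the first part\<close>
  fix h :: real and E
  assume h: "h > 0" and E: "E \<in> pde_class n"
    and q0: "\<forall>z\<in>cball (- 1 / of_real h) (1 / h). pde_q E z \<noteq> 0"
  define \<rho> where "\<rho> = 1 / h"
  have \<rho>: "\<rho> > 0" and h\<rho>: "h = 1 / \<rho>" using h by (auto simp: \<rho>_def)
  have q: "\<forall>z\<in>cball (- of_real \<rho>) \<rho>. pde_q E z \<noteq> 0" using q0 by (simp add: \<rho>_def)
  hence q\<rho>: "pde_q E (- of_real \<rho>) \<noteq> 0" using \<rho> by simp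
  obtain E' where E': "E' \<in> pde_class n" "\<And>z. pde_q E' z = pde_q E (z + - of_real \<rho>) / pde_q E (- of_real \<rho>)"
    "\<And>i z. pde_p E' i z = pde_p E i (z + - of_real \<rho>) / pde_q E (- of_real \<rho>)"
    using pde_substitution[OF E q\<rho>] by blast
  have q': "\<forall>z\<in>cball 0 \<rho>. pde_q E' z \<noteq> 0"
    using q q\<rho> translate_disc[of _ "- of_real \<rho>" "- of_real \<rho>" \<rho>] unfolding E'(2) by auto
  have "isometric_problems n \<rho> (A_d \<rho> E') (A_h_plus (1 / \<rho>) E)"
    by (rule isometric_if_symbols_translated[OF \<rho> E'(1) E q' q]) (use q\<rho> in \<open>simp add: E'(2,3)\<close>)
  thus "\<exists>E'\<in>pde_class n. (\<forall>z\<in>cball 0 (1 / h). pde_q E' z \<noteq> 0) \<and>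
      isometric_problems n (1 / h) (A_d (1 / h) E') (A_h_plus h E)"
    using E'(1) q' unfolding \<rho>_def[symmetric] h\<rho>[symmetric] by blast
qed

end
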